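(* Consider all marked ordered trees with $n$ nodes as equally likely. Then the expected number of deepest nodes of such a tree tends to $\frac{5}{3}$ as $n\to\infty$.
   Context: An ordered tree is a rooted plane tree (children of each node are linearly ordered). A marked ordered tree is an ordered tree in which each edge that is the rightmost edge from a node to its children and which does not lead to a leaf (endnode) may additionally be either marked or unmarked; two marked ordered trees are different if the underlying ordered trees differ or the sets of marked edges differ. The number of marked ordered trees with $n$ nodes is $1,1,3,10,36,\dots$ for $n=1,2,3,\dots$. The level of a node is the number of nodes on the path from the root to it; the height of a tree is the maximal level of its nodes, and the deepest nodes are the nodes whose level equals the height. *)

theory Defs
  imports "HOL-Probability.Probability"
begin

datatype otree = Node (children: "otree list")

text \<open>
  A node is identified with the list of child indices (counted from 0, left to right) leading to it
  from the root; the root is the empty list. An edge is identified with its lower endpoint.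
\<close>

function nodes :: "otree \<Rightarrow> nat list set" where
  "nodes (Node ts) = insert [] (\<Union>i\<in>{..<length ts}. (#) i ` nodes (ts ! i))"
  by pat_completeness auto
termination
  by (relation "Wellfounded.measure size") (auto simp: less_Suc_eq_le intro!: size_list_estimation' nth_mem)

definition level :: "nat list \<Rightarrow> nat" where
  "level p = Suc (length p)"

definition height :: "otree \<Rightarrow> nat" where
  "height t = Max (level ` nodes t)"

definition deepest_nodes :: "otree \<Rightarrow> nat list set" where
  "deepest_nodes t = {p \<in> nodes t. level p = height t}"

text \<open>
  The edge from \<open>p\<close> to its child \<open>p @ [i]\<close> may be marked if there is no further sibling to
  the right and the child has itself a child.
\<close>

definition markable_edges :: "otree \<Rightarrow> nat list set" where
  "markable_edges t =
     {p @ [i] |p i. p @ [i] \<in> nodes t \<and> p @ [Suc i] \<notin> nodes t \<and> p @ [i, 0] \<in> nodes t}"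

text \<open>A marked ordered tree is an ordered tree together with its set of marked edges.\<close>

definition marked_trees :: "nat \<Rightarrow> (otree \<times> nat list set) set" where
  "marked_trees n = {(t, M). card (nodes t) = n \<and> M \<subseteq> markable_edges t}"

lemma finite_nodes: "finite (nodes t)"
  by (induction t rule: nodes.induct) auto

lemma card_nodes_Node: "card (nodes (Node ts)) = Suc (\<Sum>t\<leftarrow>ts. card (nodes t))"
proof -
  have "card (\<Union>i\<in>{..<length ts}. (#) i ` nodes (ts ! i)) =
        (\<Sum>i<length ts. card ((#) i ` nodes (ts ! i)))"
    by (rule card_UN_disjoint) (auto simp: finite_nodes)
  also have "\<dots> = (\<Sum>i<length ts. card (nodes (ts ! i)))"
    by (intro sum.cong refl card_image) auto
  also have "\<dots> = (\<Sum>t\<leftarrow>ts. card (nodes t))"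
    by (simp add: sum_list_sum_nth atLeast0LessThan)
  finally have eq: "card (\<Union>i\<in>{..<length ts}. (#) i ` nodes (ts ! i)) = (\<Sum>t\<leftarrow>ts. card (nodes t))" .
  have "finite (\<Union>i\<in>{..<length ts}. (#) i ` nodes (ts ! i))"
    by (auto simp: finite_nodes)
  moreover have "[] \<notin> (\<Union>i\<in>{..<length ts}. (#) i ` nodes (ts ! i))"
    by auto
  ultimately show ?thesis
    by (simp add: eq)
qed

lemma finite_trees: "finite {t. card (nodes t) \<le> n}"
proof (induction n)
  case 0
  have "{t. card (nodes t) \<le> 0} = {}"
  proof -
    have "card (nodes t) \<noteq> 0" for t
      by (cases t) (simp add: card_nodes_Node del: nodes.simps)
    then show ?thesis by auto
  qed
  then show ?case by (simp only: finite.emptyI)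
next
  case (Suc n)
  let ?A = "{t. card (nodes t) \<le> n}"
  have "t \<in> Node ` {ts. set ts \<subseteq> ?A \<and> length ts \<le> n}" if t: "card (nodes t) \<le> Suc n" for t
  proof (cases t)
    case (Node ts)
    have s: "(\<Sum>t\<leftarrow>ts. card (nodes t)) \<le> n"
      using t by (simp add: Node card_nodes_Node del: nodes.simps)
    have "card (nodes u) \<le> n" if "u \<in> set ts" for u
      using member_le_sum_list[of "card (nodes u)" "map (\<lambda>t. card (nodes t)) ts"] that s by auto
    moreover have "length ts \<le> (\<Sum>t\<leftarrow>ts. card (nodes t))"
    proof (induction ts)
      case (Cons u us)
      have "card (nodes u) \<ge> 1" by (cases u) (simp add: card_nodes_Node del: nodes.simps)
      then show ?case using Cons by simp
    qed simp
    ultimately show ?thesis using s Node by auto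
  qed
  then have "{t. card (nodes t) \<le> Suc n} \<subseteq> Node ` {ts. set ts \<subseteq> ?A \<and> length ts \<le> n}"
    by blast
  then show ?case
    using finite_lists_length_le[OF Suc] by (meson finite_imageI finite_subset)
qed

lemma finite_marked_trees: "finite (marked_trees n)"
proof -
  have "finite (Pow (markable_edges t))" for t
    by (rule finite_Pow_iff[THEN iffD2], rule finite_subset[OF _ finite_nodes[of t]])
       (auto simp: markable_edges_def)
  then have "finite (SIGMA t:{t. card (nodes t) \<le> n}. Pow (markable_edges t))"
    using finite_trees by blast
  then show ?thesis
    by (rule finite_subset[rotated]) (auto simp: marked_trees_def)
qed

lemma marked_trees_nonempty:
  assumes "n \<ge> 1"
  shows "marked_trees n \<noteq> {}"
proof -
  have "card (nodes (Node (replicate (n - 1) (Node [])))) = n"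
    using assms by (simp add: card_nodes_Node sum_list_replicate del: nodes.simps)
  then have "(Node (replicate (n - 1) (Node [])), {}) \<in> marked_trees n"
    by (simp add: marked_trees_def)
  then show ?thesis by blast
qed

end

(*
  Let F be the generating function of marked trees, F_h that of the trees of height at most h, and
  D_h that of the nodes at level h in the latter trees. Splitting off the last child of the root gives
  F_{h+1} = X (2 - X) / (1 - F_h) - X, and differentiating this recursion with respect to a variable
  that marks level h gives the key identity D_{h+1} = (F_{h+1} - F_h) / (1 - F_h) for h >= 1.

  Write a_n, g_n for the coefficients of F and 1 / (1 - F). The dominant singularity is 1/5, where
  F = 2/5, so a_{n-1} / a_n -> 1/5 and g_n / a_n -> 1 / (1 - 2/5)^2 = 25/9, while the coefficients of
  F_h and 1 / (1 - F_h) are o(a_n) for fixed h. In the convolution [X^n] sum_h (F_{h+1} - F_h) / (1 - F_h),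
  the terms whose second factor has bounded size m contribute a_{n-m} g_m up to o(a_n), in total
  (sum_m g_m / 5^m) a_n = 5/3 a_n. The terms whose first factor has bounded size k have h < k and are
  o(a_n). The remaining terms are bounded by those of the convolution F / (1 - F), where they amount
  to (25/9 - 5/3 - 25/9 * 2/5) a_n = 0 in the limit.
*)

theory Submission
  imports Defs "HOL-Real_Asymp.Real_Asymp"
begin

subsection \<open>Splitting off the last child of the root\<close>

declare nodes.simps [simp del]

text \<open>Makes non-leaf trees pairs of trees, as in the rotation correspondence with binary
  trees. The last child is split off because only edges to last children can be marked; the nodes of
  \<open>s\<close> also keep their index lists.\<close>

definition snoc :: "otree \<Rightarrow> otree \<Rightarrow> otree" where
  "snoc s t = Node (children s @ [t])"

lemma otree_cases_snoc:
  obtains "t = Node []" | s u where "t = snoc s u"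
proof (cases t)
  case (Node ts)
  show ?thesis
  proof (cases ts rule: rev_cases)
    case Nil
    then show ?thesis using Node that(1) by simp
  next
    case (snoc us u)
    then show ?thesis using Node that(2)[of "Node us" u] by (simp add: snoc_def)
  qed
qed

lemma snoc_neq_Nil [simp]: "snoc s t \<noteq> Node []"
  by (simp add: snoc_def)

lemma snoc_inject [simp]: "snoc s t = snoc s' t' \<longleftrightarrow> s = s' \<and> t = t'"
  by (cases s; cases s') (simp add: snoc_def)

lemma Nil_in_nodes [simp]: "[] \<in> nodes t"
  by (cases t) (simp add: nodes.simps)

lemma nodes_Nil [simp]: "nodes (Node []) = {[]}"
  by (simp add: nodes.simps)

lemma Cons_in_nodes: "i # p \<in> nodes t \<longleftrightarrow> i < length (children t) \<and> p \<in> nodes (children t ! i)"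
  by (cases t) (auto simp: nodes.simps)

lemma nodes_snoc: "nodes (snoc s t) = nodes s \<union> (#) (length (children s)) ` nodes t"
proof (rule set_eqI)
  fix p
  show "p \<in> nodes (snoc s t) \<longleftrightarrow> p \<in> nodes s \<union> (#) (length (children s)) ` nodes t"
    by (cases p) (auto simp: Cons_in_nodes snoc_def nth_append less_Suc_eq)
qed

lemma Cons_length_notin_nodes: "length (children s) # p \<notin> nodes s"
  by (simp add: Cons_in_nodes)

lemma card_nodes_snoc: "card (nodes (snoc s t)) = card (nodes s) + card (nodes t)"
  unfolding nodes_snoc
  by (subst card_Un_disjoint) (auto simp: finite_nodes card_image Cons_length_notin_nodes)

lemma card_nodes_pos: "card (nodes t) > 0"
  using finite_nodes[of t] by (metis Nil_in_nodes card_gt_0_iff empty_iff)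

lemma otree_snoc_induct [case_names leaf snoc]:
  assumes "P (Node [])" and "\<And>s t. P s \<Longrightarrow> P t \<Longrightarrow> P (snoc s t)"
  shows "P t"
proof (induction "card (nodes t)" arbitrary: t rule: less_induct)
  case less
  show ?case
  proof (cases t rule: otree_cases_snoc)
    case (2 s u)
    have "card (nodes s) < card (nodes t)" "card (nodes u) < card (nodes t)"
      using card_nodes_pos[of s] card_nodes_pos[of u] 2 by (auto simp: card_nodes_snoc)
    then show ?thesis using less assms(2) 2 by blast
  qed (use assms in simp)
qed

section \<open>Height and level sizes when a last child is added\<close>

lemma height_Nil [simp]: "height (Node []) = 1"
  by (simp add: height_def level_def)

lemma height_snoc: "height (snoc s t) = max (height s) (Suc (height t))"
proof -
  have ne: "nodes s \<noteq> {}" for s using Nil_in_nodes by blast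
  have "level ` nodes (snoc s t) = level ` nodes s \<union> Suc ` level ` nodes t"
    by (force simp: nodes_snoc level_def image_Un image_image)
  moreover have "Max (Suc ` level ` nodes t) = Suc (Max (level ` nodes t))"
    using mono_Max_commute[of Suc "level ` nodes t"] finite_nodes[of t] ne[of t] by (simp add: mono_Suc)
  ultimately show ?thesis
    unfolding height_def using ne finite_nodes by (simp add: Max_Un)
qed

lemma height_pos: "height t \<ge> 1"
  by (induction t rule: otree_snoc_induct) (auto simp: height_snoc)

lemma height_le_card_nodes: "height t \<le> card (nodes t)"
proof (induction t rule: otree_snoc_induct)
  case (snoc s t)
  then show ?case using card_nodes_pos[of s] by (auto simp: height_snoc card_nodes_snoc)
qed simp

definition level_card :: "nat \<Rightarrow> otree \<Rightarrow> nat" where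
  "level_card h t = card {p \<in> nodes t. level p = h}"

lemma level_card_Nil: "level_card h (Node []) = of_bool (h = 1)"
  by (auto simp: level_card_def level_def)

lemma level_card_snoc: "level_card (Suc h) (snoc s t) = level_card (Suc h) s + level_card h t"
proof -
  have "{p \<in> nodes (snoc s t). level p = Suc h} =
     {p \<in> nodes s. level p = Suc h} \<union> (#) (length (children s)) ` {p \<in> nodes t. level p = h}"
    by (auto simp: nodes_snoc level_def)
  moreover have "{p \<in> nodes s. level p = Suc h} \<inter> (#) (length (children s)) ` {p \<in> nodes t. level p = h} = {}"
    by (auto simp: Cons_length_notin_nodes)
  ultimately show ?thesis
    unfolding level_card_def by (simp add: card_Un_disjoint finite_nodes card_image)
qed

lemma level_card_eq_0:
  assumes "height t < h"
  shows "level_card h t = 0"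
proof -
  have "level p \<le> height t" if "p \<in> nodes t" for p
    using that by (simp add: height_def finite_nodes)
  then have "{p \<in> nodes t. level p = h} = {}" using assms by fastforce
  then show ?thesis by (simp only: level_card_def card.empty)
qed

lemma card_deepest_nodes: "card (deepest_nodes t) = level_card (height t) t"
  by (simp add: deepest_nodes_def level_card_def)

text \<open>
  Adding a new last child to a node revokes the markability of its edge to the former last child.
  Therefore trees are also counted with only those edges markable that do not start at the root.
\<close>

definition inner_edges :: "otree \<Rightarrow> nat list set" where
  "inner_edges t = {p \<in> markable_edges t. length p \<ge> 2}"

lemma finite_markable_edges: "finite (markable_edges t)"
  by (rule finite_subset[OF _ finite_nodes[of t]]) (auto simp: markable_edges_def)

lemma Nil_notin_markable_edges: "[] \<notin> markable_edges t"
  by (simp add: markable_edges_def)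

lemma append_in_markable_edges:
  "p @ [i] \<in> markable_edges t \<longleftrightarrow>
     p @ [i] \<in> nodes t \<and> p @ [Suc i] \<notin> nodes t \<and> p @ [i, 0] \<in> nodes t"
  unfolding markable_edges_def by blast

lemma singleton_in_markable_edges:
  "[i] \<in> markable_edges t \<longleftrightarrow> Suc i = length (children t) \<and> children t ! i \<noteq> Node []"
proof -
  have leaf: "children u = [] \<longleftrightarrow> u = Node []" for u
    by (metis otree.sel otree.exhaust_sel)
  have "[i] \<in> markable_edges t \<longleftrightarrow>
     i < length (children t) \<and> \<not> Suc i < length (children t) \<and> children (children t ! i) \<noteq> []"
    using append_in_markable_edges[of "[]" i t] by (simp add: Cons_in_nodes) blast
  also have "\<dots> \<longleftrightarrow> Suc i = length (children t) \<and> children t ! i \<noteq> Node []"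
    unfolding leaf by (metis Suc_lessI lessI less_irrefl)
  finally show ?thesis .
qed

lemma Cons_in_markable_edges:
  assumes "p \<noteq> []"
  shows "i # p \<in> markable_edges t \<longleftrightarrow> i < length (children t) \<and> p \<in> markable_edges (children t ! i)"
proof -
  obtain q j where p: "p = q @ [j]" using assms by (cases p rule: rev_cases) auto
  show ?thesis
    using append_in_markable_edges[of "i # q" j t] append_in_markable_edges[of q j "children t ! i"]
    by (auto simp: p Cons_in_nodes)
qed

lemma markable_edges_Nil: "markable_edges (Node []) = {}"
  by (auto simp: markable_edges_def)

lemma inner_edges_snoc:
  "inner_edges (snoc s t) = inner_edges s \<union> (#) (length (children s)) ` markable_edges t"
proof (rule set_eqI)
  fix p
  show "p \<in> inner_edges (snoc s t) \<longleftrightarrow> p \<in> inner_edges s \<union> (#) (length (children s)) ` markable_edges t"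
  proof (cases p)
    case (Cons i q)
    show ?thesis
      by (cases "q = []")
        (auto simp: Cons inner_edges_def Cons_in_markable_edges Nil_notin_markable_edges
          snoc_def nth_append less_Suc_eq Suc_le_eq)
  qed (auto simp: inner_edges_def)
qed

text \<open>Of the edges at the root only the new one is rightmost, and it is markable unless it
  leads to a leaf.\<close>

lemma markable_edges_snoc:
  "markable_edges (snoc s t) = inner_edges (snoc s t) \<union> (if t = Node [] then {} else {[length (children s)]})"
proof (rule set_eqI)
  fix p
  show "p \<in> markable_edges (snoc s t) \<longleftrightarrow>
     p \<in> inner_edges (snoc s t) \<union> (if t = Node [] then {} else {[length (children s)]})"
  proof (cases p)
    case (Cons i q)
    show ?thesis
      by (cases "q = []")
        (auto simp: Cons inner_edges_def singleton_in_markable_edges snoc_def Suc_le_eq)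
  qed (auto simp: inner_edges_def Nil_notin_markable_edges)
qed

lemma finite_inner_edges: "finite (inner_edges t)"
  by (simp add: inner_edges_def finite_markable_edges)

lemma card_inner_edges_snoc:
  "card (inner_edges (snoc s t)) = card (inner_edges s) + card (markable_edges t)"
proof -
  have "inner_edges s \<inter> (#) (length (children s)) ` markable_edges t = {}"
    by (auto simp: inner_edges_def markable_edges_def Cons_length_notin_nodes)
  then show ?thesis
    unfolding inner_edges_snoc
    by (simp add: card_Un_disjoint finite_inner_edges finite_markable_edges card_image)
qed

lemma card_markable_edges_snoc:
  "card (markable_edges (snoc s t)) =
     card (inner_edges s) + card (markable_edges t) + of_bool (t \<noteq> Node [])"
proof -
  have "inner_edges (snoc s t) \<inter> (if t = Node [] then {} else {[length (children s)]}) = {}"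
    by (auto simp: inner_edges_def)
  then show ?thesis
    unfolding markable_edges_snoc[of s t]
    by (subst card_Un_disjoint) (auto simp: finite_inner_edges card_inner_edges_snoc)
qed

text \<open>The number of admissible sets of marked edges, so that marked trees are counted as
  weighted ordered trees.\<close>

definition weight :: "otree \<Rightarrow> real" where
  "weight t = 2 ^ card (markable_edges t)"

definition inner_weight :: "otree \<Rightarrow> real" where
  "inner_weight t = 2 ^ card (inner_edges t)"

lemma weight_pos: "weight t > 0" and inner_weight_pos: "inner_weight t > 0"
  by (simp_all add: weight_def inner_weight_def)

lemma weight_Nil [simp]: "weight (Node []) = 1" and inner_weight_Nil [simp]: "inner_weight (Node []) = 1"
  by (simp_all add: weight_def inner_weight_def inner_edges_def markable_edges_Nil)

lemma inner_weight_snoc: "inner_weight (snoc s t) = inner_weight s * weight t"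
  by (simp add: weight_def inner_weight_def card_inner_edges_snoc power_add)

text \<open>The edge to the last child can be marked in two ways, or in one if the child is a leaf.
  The edge to the previous last child is no longer markable, whence
  \<open>inner_weight s\<close>.\<close>

lemma weight_snoc: "weight (snoc s t) = inner_weight s * (weight t * (2 - of_bool (t = Node [])))"
  by (simp add: weight_def inner_weight_def card_markable_edges_snoc power_add markable_edges_Nil)

section \<open>Generating functions of weighted trees by number of nodes\<close>

definition tree_fps :: "(otree \<Rightarrow> real) \<Rightarrow> real fps" where
  "tree_fps f = Abs_fps (\<lambda>n. \<Sum>t | card (nodes t) = n. f t)"

lemma finite_trees_eq: "finite {t. card (nodes t) = n}"
  by (rule finite_subset[OF _ finite_trees[of n]]) auto

lemma tree_fps_nth: "fps_nth (tree_fps f) n = (\<Sum>t | card (nodes t) = n. f t)"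
  by (simp add: tree_fps_def)

lemma tree_fps_diff: "tree_fps (\<lambda>t. f t - g t) = tree_fps f - tree_fps g"
  by (rule fps_ext) (simp add: tree_fps_nth sum_subtractf)

lemma tree_fps_scale: "tree_fps (\<lambda>t. c * f t) = fps_const c * tree_fps f"
  by (rule fps_ext) (simp add: tree_fps_nth sum_distrib_left)

lemma tree_fps_leaf: "tree_fps (\<lambda>t. c * of_bool (t = Node [])) = fps_const c * fps_X"
proof (rule fps_ext)
  fix n
  have "(\<Sum>t | card (nodes t) = n. of_bool (t = Node [])) =
     (\<Sum>t\<in>{t. card (nodes t) = n} \<inter> {Node []}. (1::real))"
    by (rule sum.mono_neutral_cong_right) (auto simp: finite_trees_eq)
  also have "\<dots> = of_bool (n = 1)"
    by (cases "n = 1") (auto simp: Int_insert_right)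
  finally have "(\<Sum>t | card (nodes t) = n. of_bool (t = Node [])) = (of_bool (n = 1) :: real)" .
  then show "fps_nth (tree_fps (\<lambda>t. c * of_bool (t = Node []))) n = fps_nth (fps_const c * fps_X) n"
    by (simp add: tree_fps_nth sum_distrib_left[symmetric])
qed

lemma trees_snoc_decomp:
  "{t. card (nodes t) = n} - {Node []} =
     (\<lambda>(i, s, t). snoc s t) ` (SIGMA i:{..n}. {s. card (nodes s) = i} \<times> {t. card (nodes t) = n - i})"
proof (intro set_eqI iffI)
  fix t assume "t \<in> {t. card (nodes t) = n} - {Node []}"
  then obtain s u where "t = snoc s u" "card (nodes t) = n"
    by (cases t rule: otree_cases_snoc) auto
  then show "t \<in> (\<lambda>(i, s, t). snoc s t) ` (SIGMA i:{..n}. {s. card (nodes s) = i} \<times> {t. card (nodes t) = n - i})"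
    by (intro image_eqI[of _ _ "(card (nodes s), s, u)"]) (auto simp: card_nodes_snoc)
qed (auto simp: card_nodes_snoc)

text \<open>Node counts add under \<open>snoc\<close>, so a weight that factors yields a Cauchy
  product. Two products are allowed because a node at a given level may lie in \<open>s\<close> or
  in \<open>t\<close>.\<close>

lemma tree_fps_snoc2:
  assumes "\<And>s t. f (snoc s t) = p s * q t + p' s * q' t"
  shows "tree_fps f = fps_const (f (Node [])) * fps_X + tree_fps p * tree_fps q + tree_fps p' * tree_fps q'"
proof (rule fps_ext)
  fix n
  let ?S = "\<lambda>n. {t. card (nodes t) = n}"
  let ?I = "SIGMA i:{..n}. ?S i \<times> ?S (n - i)"
  have conv: "fps_nth (tree_fps a * tree_fps b) n = (\<Sum>(i, s, t)\<in>?I. a s * b t)" for a b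
  proof -
    have "fps_nth (tree_fps a * tree_fps b) n = (\<Sum>i\<in>{..n}. \<Sum>(s, t)\<in>?S i \<times> ?S (n - i). a s * b t)"
      by (simp add: fps_mult_nth tree_fps_nth sum_product sum.cartesian_product atLeast0AtMost)
    also have "\<dots> = (\<Sum>(i, s, t)\<in>?I. a s * b t)"
      by (subst sum.Sigma) (auto simp: finite_trees_eq)
    finally show ?thesis .
  qed
  have inj: "inj_on (\<lambda>(i, s, t). snoc s t) ?I"
    by (auto simp: inj_on_def)
  have "(\<Sum>t\<in>?S n. f t) =
     (\<Sum>t\<in>?S n. f (Node []) * of_bool (t = Node [])) + (\<Sum>t\<in>?S n. f t * of_bool (t \<noteq> Node []))"
    by (subst sum.distrib[symmetric]) (auto intro!: sum.cong)
  also have "(\<Sum>t\<in>?S n. f t * of_bool (t \<noteq> Node [])) = (\<Sum>t\<in>?S n - {Node []}. f t)"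
    by (rule sum.mono_neutral_cong_right) (auto simp: finite_trees_eq)
  also have "\<dots> = (\<Sum>(i, s, t)\<in>?I. f (snoc s t))"
    unfolding trees_snoc_decomp by (subst sum.reindex[OF inj]) (simp add: case_prod_unfold)
  also have "\<dots> = (\<Sum>(i, s, t)\<in>?I. p s * q t) + (\<Sum>(i, s, t)\<in>?I. p' s * q' t)"
    by (simp add: assms case_prod_unfold sum.distrib)
  finally show "fps_nth (tree_fps f) n =
     fps_nth (fps_const (f (Node [])) * fps_X + tree_fps p * tree_fps q + tree_fps p' * tree_fps q') n"
    using tree_fps_leaf[of "f (Node [])"]
    by (simp add: conv flip: tree_fps_nth)
qed

lemma tree_fps_snoc:
  assumes "\<And>s t. f (snoc s t) = p s * q t"
  shows "tree_fps f = fps_const (f (Node [])) * fps_X + tree_fps p * tree_fps q"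
proof -
  have "tree_fps (\<lambda>_. 0) = 0" by (rule fps_ext) (simp add: tree_fps_nth)
  then show ?thesis
    using tree_fps_snoc2[of f p q "\<lambda>_. 0" "\<lambda>_. 0"] assms by simp
qed

subsection \<open>Generating functions\<close>

text \<open>In the overview \<open>height_fps h\<close> is F_h and \<open>level_fps h\<close> is
  D_h. The \<open>inner\<close> variants leave the root edges unmarked.\<close>

definition height_fps :: "nat \<Rightarrow> real fps" where
  "height_fps h = tree_fps (\<lambda>t. weight t * of_bool (height t \<le> h))"

definition inner_height_fps :: "nat \<Rightarrow> real fps" where
  "inner_height_fps h = tree_fps (\<lambda>t. inner_weight t * of_bool (height t \<le> h))"

definition level_fps :: "nat \<Rightarrow> real fps" where
  "level_fps h = tree_fps (\<lambda>t. weight t * of_bool (height t \<le> h) * real (level_card h t))"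

definition inner_level_fps :: "nat \<Rightarrow> real fps" where
  "inner_level_fps h = tree_fps (\<lambda>t. inner_weight t * of_bool (height t \<le> h) * real (level_card h t))"

lemma height_le_1_iff: "height t \<le> 1 \<longleftrightarrow> t = Node []"
proof (cases t rule: otree_cases_snoc)
  case (2 s u)
  then show ?thesis using height_pos[of u] by (simp add: height_snoc)
qed simp

lemma height_fps_1: "height_fps 1 = fps_X"
proof -
  have "weight t * of_bool (height t \<le> 1) = 1 * of_bool (t = Node [])" for t
    by (cases "t = Node []") (simp_all only: height_le_1_iff, simp_all)
  then show ?thesis
    unfolding height_fps_def using tree_fps_leaf[of 1] by simp
qed

lemma height_snoc_le_Suc: "height (snoc s t) \<le> Suc h \<longleftrightarrow> height s \<le> Suc h \<and> height t \<le> h"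
  by (simp add: height_snoc)

lemma inner_height_fps_Suc:
  "inner_height_fps (Suc h) = fps_X + inner_height_fps (Suc h) * height_fps h"
proof -
  have "inner_height_fps (Suc h) =
    fps_const (inner_weight (Node []) * of_bool (height (Node []) \<le> Suc h)) * fps_X
      + inner_height_fps (Suc h) * height_fps h"
    unfolding inner_height_fps_def height_fps_def
    by (rule tree_fps_snoc) (simp add: inner_weight_snoc height_snoc_le_Suc)
  then show ?thesis by simp
qed

text \<open>Counts a last child together with the mark of its edge: two choices for every tree, less
  one for the leaf, which meets the height bound as h >= 1.\<close>

lemma last_child_fps:
  assumes "h \<ge> 1"
  shows "tree_fps (\<lambda>t. weight t * (2 - of_bool (t = Node [])) * of_bool (height t \<le> h)) =
    2 * height_fps h - fps_X"
proof -
  have "weight t * (2 - of_bool (t = Node [])) * of_bool (height t \<le> h) =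
      2 * (weight t * of_bool (height t \<le> h)) - 1 * of_bool (t = Node [])" for t
    using assms by (cases "t = Node []") simp_all
  then show ?thesis
    using tree_fps_leaf[of 1]
    by (simp only: tree_fps_diff tree_fps_scale height_fps_def) (simp add: numeral_fps_const)
qed

lemma height_fps_Suc:
  assumes "h \<ge> 1"
  shows "height_fps (Suc h) = fps_X + inner_height_fps (Suc h) * (2 * height_fps h - fps_X)"
proof -
  have "height_fps (Suc h) =
    fps_const (weight (Node []) * of_bool (height (Node []) \<le> Suc h)) * fps_X
      + inner_height_fps (Suc h) * tree_fps (\<lambda>t. weight t * (2 - of_bool (t = Node [])) * of_bool (height t \<le> h))"
    unfolding inner_height_fps_def height_fps_def
    by (rule tree_fps_snoc) (simp add: weight_snoc height_snoc_le_Suc)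
  then show ?thesis by (simp add: last_child_fps[OF assms])
qed

lemma inner_weight_fps: "tree_fps inner_weight = fps_X + tree_fps inner_weight * tree_fps weight"
  using tree_fps_snoc[of inner_weight inner_weight weight] inner_weight_snoc by simp

lemma weight_fps:
  "tree_fps weight = fps_X + tree_fps inner_weight * (2 * tree_fps weight - fps_X)"
proof -
  have "weight t * (2 - of_bool (t = Node [])) = 2 * weight t - 1 * of_bool (t = Node [])" for t
    by (cases "t = Node []") simp_all
  then have "tree_fps (\<lambda>t. weight t * (2 - of_bool (t = Node []))) = 2 * tree_fps weight - fps_X"
    using tree_fps_leaf[of 1]
    by (simp only: tree_fps_diff tree_fps_scale) (simp add: numeral_fps_const)
  then show ?thesis
    using tree_fps_snoc[of weight inner_weight "\<lambda>t. weight t * (2 - of_bool (t = Node []))"] weight_snoc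
    by simp
qed

lemma inner_level_fps_Suc:
  assumes "h \<ge> 1"
  shows "inner_level_fps (Suc h) =
    inner_level_fps (Suc h) * height_fps h + inner_height_fps (Suc h) * level_fps h"
proof -
  have "inner_level_fps (Suc h) =
    fps_const (inner_weight (Node []) * of_bool (height (Node []) \<le> Suc h) * real (level_card (Suc h) (Node []))) * fps_X
      + inner_level_fps (Suc h) * height_fps h + inner_height_fps (Suc h) * level_fps h"
    unfolding inner_level_fps_def inner_height_fps_def height_fps_def level_fps_def
    by (rule tree_fps_snoc2)
       (simp add: inner_weight_snoc height_snoc_le_Suc level_card_snoc distrib_left)
  then show ?thesis using assms by (simp add: level_card_Nil)
qed

lemma level_fps_1: "level_fps 1 = fps_X"
proof -
  have "weight t * of_bool (height t \<le> 1) * real (level_card 1 t) = 1 * of_bool (t = Node [])" for t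
    by (cases "t = Node []") (simp_all only: height_le_1_iff, simp_all add: level_card_Nil)
  then show ?thesis
    unfolding level_fps_def using tree_fps_leaf[of 1] by simp
qed

text \<open>A node at level \<open>Suc h\<close> lies in the subtree of an earlier child or of the
  last one. The correction for \<open>h = 1\<close> discards the mark of an edge to a leaf, whose
  only node has level 1.\<close>

lemma level_fps_Suc:
  assumes "h \<ge> 1"
  shows "level_fps (Suc h) = inner_level_fps (Suc h) * (2 * height_fps h - fps_X) +
    inner_height_fps (Suc h) * (2 * level_fps h - of_bool (h = 1) * fps_X)"
proof -
  have eq': "tree_fps (\<lambda>t. weight t * (2 - of_bool (t = Node [])) * of_bool (height t \<le> h) * real (level_card h t))
    = 2 * level_fps h - of_bool (h = 1) * fps_X"
  proof -
    have "weight t * (2 - of_bool (t = Node [])) * of_bool (height t \<le> h) * real (level_card h t) =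
        2 * (weight t * of_bool (height t \<le> h) * real (level_card h t)) - of_bool (h = 1) * of_bool (t = Node [])" for t
      using assms by (cases "t = Node []") (simp_all add: level_card_Nil)
    then show ?thesis
      using tree_fps_leaf[of "of_bool (h = 1)"]
      by (simp only: tree_fps_diff tree_fps_scale level_fps_def) (simp add: numeral_fps_const)
  qed
  have "level_fps (Suc h) =
    fps_const (weight (Node []) * of_bool (height (Node []) \<le> Suc h) * real (level_card (Suc h) (Node []))) * fps_X
      + inner_level_fps (Suc h) * tree_fps (\<lambda>t. weight t * (2 - of_bool (t = Node [])) * of_bool (height t \<le> h))
      + inner_height_fps (Suc h) * tree_fps (\<lambda>t. weight t * (2 - of_bool (t = Node [])) * of_bool (height t \<le> h) * real (level_card h t))"
    unfolding inner_level_fps_def inner_height_fps_def level_fps_def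
    by (rule tree_fps_snoc2)
       (simp add: weight_snoc height_snoc_le_Suc level_card_snoc algebra_simps)
  then show ?thesis using assms by (simp add: last_child_fps[OF assms] eq' level_card_Nil)
qed

text \<open>Dropping the root of a tree whose root edges are unmarkable leaves an arbitrary list of trees.\<close>

definition forest_fps :: "nat \<Rightarrow> real fps" where
  "forest_fps h = fps_shift 1 (inner_height_fps (Suc h))"

definition all_forest_fps :: "real fps" where
  "all_forest_fps = fps_shift 1 (tree_fps inner_weight)"

lemma tree_fps_nth_0: "fps_nth (tree_fps f) 0 = 0"
proof -
  have "{t. card (nodes t) = 0} = {}" using card_nodes_pos by (metis (mono_tags) empty_Collect_eq less_irrefl)
  then show ?thesis unfolding tree_fps_nth by (simp only: sum.empty)
qed

text \<open>Every tree has a node, so the constant coefficient vanishes and the shift is an exact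
  division by X.\<close>

lemma tree_fps_eq_X_shift: "tree_fps f = fps_X * fps_shift 1 (tree_fps f)"
  by (rule fps_ext) (auto simp: tree_fps_nth_0 gr0_conv_Suc)

lemma inner_height_fps_eq: "inner_height_fps (Suc h) = fps_X * forest_fps h"
  unfolding forest_fps_def inner_height_fps_def by (rule tree_fps_eq_X_shift)

lemma inner_weight_fps_eq: "tree_fps inner_weight = fps_X * all_forest_fps"
  unfolding all_forest_fps_def by (rule tree_fps_eq_X_shift)

text \<open>States that \<open>forest_fps h\<close> is 1 / (1 - F_h) in a division-free form, which
  keeps the later identities polynomial.\<close>

lemma forest_fps_eq: "forest_fps h = 1 + forest_fps h * height_fps h"
proof -
  have "fps_X * forest_fps h = fps_X * (1 + forest_fps h * height_fps h)"
    using inner_height_fps_Suc[of h] by (simp add: inner_height_fps_eq algebra_simps)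
  then show ?thesis by simp
qed

lemma all_forest_fps_eq: "all_forest_fps = 1 + all_forest_fps * tree_fps weight"
proof -
  have "fps_X * all_forest_fps = fps_X * (1 + all_forest_fps * tree_fps weight)"
    using inner_weight_fps by (simp add: inner_weight_fps_eq algebra_simps)
  then show ?thesis by simp
qed

lemma height_fps_Suc_forest:
  assumes "h \<ge> 1"
  shows "height_fps (Suc h) = fps_X * (2 - fps_X) * forest_fps h - fps_X"
proof -
  have "height_fps (Suc h) = fps_X + fps_X * forest_fps h * (2 * height_fps h - fps_X)"
    using height_fps_Suc[OF assms] by (simp add: inner_height_fps_eq)
  \<comment> \<open>The added term is zero by \<open>forest_fps_eq\<close>; it trades the product G
    F for G - 1.\<close>
  also have "\<dots> = fps_X * (2 - fps_X) * forest_fps h - fps_X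
      + 2 * fps_X * (1 + forest_fps h * height_fps h - forest_fps h)"
    by (simp add: algebra_simps)
  finally show ?thesis using forest_fps_eq[of h] by simp
qed

lemma weight_fps_forest: "tree_fps weight = fps_X * (2 - fps_X) * all_forest_fps - fps_X"
proof -
  have "tree_fps weight = fps_X + fps_X * all_forest_fps * (2 * tree_fps weight - fps_X)"
    using weight_fps by (simp add: inner_weight_fps_eq)
  also have "\<dots> = fps_X * (2 - fps_X) * all_forest_fps - fps_X
      + 2 * fps_X * (1 + all_forest_fps * tree_fps weight - all_forest_fps)"
    by (simp add: algebra_simps)
  finally show ?thesis using all_forest_fps_eq by simp
qed

text \<open>This is the recursion for F_h differentiated with respect to a variable that marks level
  h. For h = 1 that variable also enters through the leaf, which gives the extra term.\<close>

lemma level_fps_Suc_forest: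
  assumes "h \<ge> 1"
  shows "level_fps (Suc h) = fps_X * forest_fps h *
    ((2 - fps_X) * forest_fps h * level_fps h - of_bool (h = 1) * fps_X)"
proof -
  let ?G = "forest_fps h" and ?F = "height_fps h" and ?D = "level_fps h" and ?Q = "inner_level_fps (Suc h)"
  have G: "?G = 1 + ?G * ?F" by (rule forest_fps_eq)
  have Q: "?Q = ?Q * ?F + fps_X * ?G * ?D"
    using inner_level_fps_Suc[OF assms] by (simp add: inner_height_fps_eq)
  \<comment> \<open>Q (1 - F) = X G D, multiplied by G = 1 / (1 - F).\<close>
  have "?Q = fps_X * ?G * ?G * ?D" using G Q by algebra
  then show ?thesis
    using level_fps_Suc[OF assms] G unfolding inner_height_fps_eq by algebra
qed

text \<open>The identity 1/(1-a) - 1/(1-b) = (a-b) / ((1-a)(1-b)) in terms of forest series.\<close>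

lemma forest_fps_diff:
  "forest_fps (Suc h) - forest_fps h = forest_fps (Suc h) * forest_fps h * (height_fps (Suc h) - height_fps h)"
  using forest_fps_eq[of h] forest_fps_eq[of "Suc h"] by algebra

text \<open>
  Both sides satisfy the same recursion, since the map \<open>F \<mapsto> X (2 - X) / (1 - F) - X\<close> taking
  \<^term>\<open>height_fps h\<close> to \<^term>\<open>height_fps (Suc h)\<close> is fractional linear.
\<close>

lemma level_fps_eq:
  assumes "h \<ge> 1"
  shows "level_fps (Suc h) = (height_fps (Suc h) - height_fps h) * forest_fps h"
  using assms
proof (induction h rule: dec_induct)
  case base
  \<comment> \<open>Here \<open>forest_fps 1\<close> is 1 / (1 - X), and both sides of the claim
    become X^2 / (1 - X)^2.\<close>
  have "forest_fps 1 = 1 + forest_fps 1 * fps_X"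
    using forest_fps_eq[of 1] by (simp only: height_fps_1)
  then show ?case
    using level_fps_Suc_forest[of 1] height_fps_Suc_forest[of 1] 
    unfolding height_fps_1 level_fps_1 by simp algebra
next
  case (step h)
  have 1: "height_fps (Suc (Suc h)) - height_fps (Suc h) =
      fps_X * (2 - fps_X) * (forest_fps (Suc h) - forest_fps h)"
    using height_fps_Suc_forest[of h] height_fps_Suc_forest[of "Suc h"] step.hyps(1)
    by (simp add: right_diff_distrib)
  have 2: "level_fps (Suc (Suc h)) = fps_X * forest_fps (Suc h) *
    ((2 - fps_X) * forest_fps (Suc h) * level_fps (Suc h))"
    using level_fps_Suc_forest[of "Suc h"] step.hyps by simp
  show ?case
    unfolding 1 2 forest_fps_diff step.IH by (simp add: algebra_simps)
qed

subsection \<open>The total number of deepest nodes\<close>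

abbreviation num_trees :: "nat \<Rightarrow> real" where
  "num_trees \<equiv> fps_nth (tree_fps weight)"

abbreviation num_forests :: "nat \<Rightarrow> real" where
  "num_forests \<equiv> fps_nth all_forest_fps"

section \<open>Coefficients: sign, monotonicity and stabilisation in the height\<close>

lemma weight_fps_nth_nonneg: "num_trees n \<ge> 0"
  unfolding tree_fps_nth by (intro sum_nonneg less_imp_le[OF weight_pos])

lemma height_fps_nth_nonneg: "fps_nth (height_fps h) n \<ge> 0"
  unfolding height_fps_def tree_fps_nth
  by (intro sum_nonneg mult_nonneg_nonneg less_imp_le[OF weight_pos]) auto

lemma height_fps_nth_mono:
  assumes "h \<le> h'"
  shows "fps_nth (height_fps h) n \<le> fps_nth (height_fps h') n"
  unfolding height_fps_def tree_fps_nth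
  using assms by (intro sum_mono mult_left_mono less_imp_le[OF weight_pos]) auto

lemma height_fps_nth_eq:
  assumes "n \<le> h"
  shows "fps_nth (height_fps h) n = num_trees n"
  unfolding height_fps_def tree_fps_nth
proof (intro sum.cong refl)
  fix t assume "t \<in> {t. card (nodes t) = n}"
  then have "height t \<le> h" using height_le_card_nodes[of t] assms by simp
  then show "weight t * of_bool (height t \<le> h) = weight t" by simp
qed

lemma forest_fps_nth_nonneg: "fps_nth (forest_fps h) n \<ge> 0"
  unfolding forest_fps_def inner_height_fps_def fps_shift_nth tree_fps_nth
  by (intro sum_nonneg mult_nonneg_nonneg less_imp_le[OF inner_weight_pos]) auto

lemma all_forest_fps_nth_nonneg: "num_forests n \<ge> 0"
  unfolding all_forest_fps_def fps_shift_nth tree_fps_nth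
  by (intro sum_nonneg less_imp_le[OF inner_weight_pos])

lemma forest_fps_nth_mono:
  assumes "h \<le> h'"
  shows "fps_nth (forest_fps h) n \<le> fps_nth (forest_fps h') n"
  unfolding forest_fps_def inner_height_fps_def fps_shift_nth tree_fps_nth
  using assms by (intro sum_mono mult_left_mono less_imp_le[OF inner_weight_pos]) auto

text \<open>With the root restored the tree has n + 1 nodes, hence height at most n + 1.\<close>

lemma forest_fps_nth_eq:
  assumes "n \<le> h"
  shows "fps_nth (forest_fps h) n = num_forests n"
  unfolding forest_fps_def all_forest_fps_def inner_height_fps_def fps_shift_nth tree_fps_nth
proof (intro sum.cong refl)
  fix t assume "t \<in> {t. card (nodes t) = n + 1}"
  then have "height t \<le> Suc h" using height_le_card_nodes[of t] assms by simp
  then show "inner_weight t * of_bool (height t \<le> Suc h) = inner_weight t" by simp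
qed

lemma height_fps_nth_le: "fps_nth (height_fps h) n \<le> num_trees n"
  using height_fps_nth_mono[of h "max h n" n] height_fps_nth_eq[of n "max h n"] by simp

lemma forest_fps_nth_le: "fps_nth (forest_fps h) n \<le> num_forests n"
  using forest_fps_nth_mono[of h "max h n" n] forest_fps_nth_eq[of n "max h n"] by simp

lemma card_marked_trees: "real (card (marked_trees n)) = num_trees n"
proof -
  have "marked_trees n = (SIGMA t:{t. card (nodes t) = n}. Pow (markable_edges t))"
    by (auto simp: marked_trees_def)
  then show ?thesis
    by (simp add: card_SigmaI finite_trees_eq finite_markable_edges card_Pow tree_fps_nth weight_def)
qed

lemma weight_fps_nth_pos:
  assumes "n \<ge> 1"
  shows "num_trees n > 0"
  using marked_trees_nonempty[OF assms] finite_marked_trees[of n]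
  by (simp add: card_gt_0_iff flip: card_marked_trees)

definition total_deepest :: "nat \<Rightarrow> real" where
  "total_deepest n = (\<Sum>t | card (nodes t) = n. weight t * real (card (deepest_nodes t)))"

lemma expectation_deepest:
  assumes "n \<ge> 1"
  shows "measure_pmf.expectation (pmf_of_set (marked_trees n)) (\<lambda>(t, M). real (card (deepest_nodes t))) =
    total_deepest n / num_trees n"
proof -
  have eq: "marked_trees n = (SIGMA t:{t. card (nodes t) = n}. Pow (markable_edges t))"
    by (auto simp: marked_trees_def)
  have "(\<Sum>(t, M)\<in>marked_trees n. real (card (deepest_nodes t))) = total_deepest n"
    unfolding eq total_deepest_def
    by (subst sum.Sigma[symmetric])
       (simp_all add: finite_trees_eq finite_markable_edges card_Pow weight_def)
  then show ?thesis
    using assms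
    by (subst integral_pmf_of_set)
       (simp_all add: marked_trees_nonempty finite_marked_trees flip: card_marked_trees)
qed

text \<open>For each tree only the summand at its height survives: smaller h violate the height
  bound and larger h are empty levels.\<close>

lemma total_deepest_level: "total_deepest n = (\<Sum>h=1..n. fps_nth (level_fps h) n)"
proof -
  have "real (card (deepest_nodes t)) = (\<Sum>h=1..n. of_bool (height t \<le> h) * real (level_card h t))"
    if "card (nodes t) = n" for t
  proof -
    have "(\<Sum>h=1..n. of_bool (height t \<le> h) * real (level_card h t)) =
        (\<Sum>h\<in>{height t}. of_bool (height t \<le> h) * real (level_card h t))"
      using height_pos[of t] height_le_card_nodes[of t] that
      by (intro sum.mono_neutral_right) (auto simp: level_card_eq_0)
    then show ?thesis by (simp add: card_deepest_nodes)
  qed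
  then have "total_deepest n = (\<Sum>t | card (nodes t) = n. \<Sum>h=1..n. weight t * of_bool (height t \<le> h) * real (level_card h t))"
    unfolding total_deepest_def mult.assoc sum_distrib_left[symmetric] by (intro sum.cong refl) simp
  also have "\<dots> = (\<Sum>h=1..n. fps_nth (level_fps h) n)"
    unfolding level_fps_def tree_fps_nth by (rule sum.swap)
  finally show ?thesis .
qed

text \<open>
  The contribution to the coefficient of \<open>X ^ n\<close> in \<open>\<Sum>h. level_fps (Suc h)\<close> in which the
  factor \<^term>\<open>forest_fps h\<close> of \<open>level_fps_eq\<close> has size \<open>m\<close>.
\<close>

definition deepest_part :: "nat \<Rightarrow> nat \<Rightarrow> real" where
  "deepest_part n m = (\<Sum>h=1..<n. (fps_nth (height_fps (Suc h)) (n - m) - fps_nth (height_fps h) (n - m)) *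
     fps_nth (forest_fps h) m)"

lemma total_deepest_eq:
  assumes "n \<ge> 2"
  shows "total_deepest n = (\<Sum>m\<le>n. deepest_part n m)"
proof -
  \<comment> \<open>Level 1 is split off since the key identity covers levels from 2 on; its series
    X contributes nothing for n >= 2.\<close>
  have "total_deepest n = fps_nth (level_fps 1) n + (\<Sum>h=Suc 1..n. fps_nth (level_fps h) n)"
    unfolding total_deepest_level using assms by (subst sum.atLeast_Suc_atMost) auto
  also have "fps_nth (level_fps 1) n = 0"
    unfolding level_fps_1 using assms by simp
  also have "{Suc 1..n} = Suc ` {1..<n}"
    using assms by (simp add: image_Suc_atLeastLessThan atLeastLessThanSuc_atLeastAtMost)
  also have "(\<Sum>h\<in>Suc ` {1..<n}. fps_nth (level_fps h) n) = (\<Sum>h=1..<n. fps_nth (level_fps (Suc h)) n)"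
    by (subst sum.reindex) auto
  also have "\<dots> = (\<Sum>h=1..<n. \<Sum>m\<le>n. (fps_nth (height_fps (Suc h)) (n - m) - fps_nth (height_fps h) (n - m)) *
     fps_nth (forest_fps h) m)"
  proof (intro sum.cong refl)
    fix h assume "h \<in> {1..<n}"
    then have "level_fps (Suc h) = forest_fps h * (height_fps (Suc h) - height_fps h)"
      using level_fps_eq[of h] by (simp add: mult.commute)
    then show "fps_nth (level_fps (Suc h)) n = (\<Sum>m\<le>n. (fps_nth (height_fps (Suc h)) (n - m) - fps_nth (height_fps h) (n - m)) *
     fps_nth (forest_fps h) m)"
      by (simp add: fps_mult_nth atLeast0AtMost mult.commute)
  qed
  also have "\<dots> = (\<Sum>m\<le>n. deepest_part n m)"
    unfolding deepest_part_def by (rule sum.swap)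
  finally show ?thesis by simp
qed

section \<open>Bounds by telescoping over the height\<close>

lemma sum_height_fps_diff:
  assumes "i \<le> n"
  shows "(\<Sum>h=i..<n. fps_nth (height_fps (Suc h)) k - fps_nth (height_fps h) k) =
    fps_nth (height_fps n) k - fps_nth (height_fps i) k"
  using assms by (rule sum_Suc_diff')

text \<open>Only heights above m are kept: there the forest coefficient has reached its final value
  and the increments of the tree coefficient telescope.\<close>

lemma deepest_part_lower:
  assumes "m < n"
  shows "deepest_part n m \<ge>
    (num_trees (n - m) - fps_nth (height_fps (Suc m)) (n - m)) * num_forests m"
proof -
  let ?e = "\<lambda>h. fps_nth (height_fps (Suc h)) (n - m) - fps_nth (height_fps h) (n - m)"
  have e: "?e h \<ge> 0" for h using height_fps_nth_mono[of h "Suc h"] by simp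
  \<comment> \<open>Starting at \<open>Suc m\<close> stays within the range h >= 1 even for m =
    0.\<close>
  have "num_trees (n - m) - fps_nth (height_fps (Suc m)) (n - m) = (\<Sum>h=Suc m..<n. ?e h)"
    using assms height_fps_nth_eq[of "n - m" n] by (subst sum_height_fps_diff) auto
  then have "(num_trees (n - m) - fps_nth (height_fps (Suc m)) (n - m)) * num_forests m =
      (\<Sum>h=Suc m..<n. ?e h * fps_nth (forest_fps h) m)"
    by (simp add: sum_distrib_right forest_fps_nth_eq)
  also have "\<dots> \<le> deepest_part n m"
    unfolding deepest_part_def using e forest_fps_nth_nonneg
    by (intro sum_mono2 mult_nonneg_nonneg) auto
  finally show ?thesis .
qed

lemma deepest_part_nonneg: "deepest_part n m \<ge> 0"
  unfolding deepest_part_def using height_fps_nth_mono[of _ "Suc _"]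
  by (intro sum_nonneg mult_nonneg_nonneg forest_fps_nth_nonneg) simp

text \<open>The increments vanish once h reaches n - m, so a bound on the forest coefficients below
  that height suffices, and the rest telescopes.\<close>

lemma deepest_part_upper:
  assumes "n \<ge> 1" and "\<And>h. h < n - m \<Longrightarrow> fps_nth (forest_fps h) m \<le> c" and "c \<ge> 0"
  shows "deepest_part n m \<le> num_trees (n - m) * c"
proof -
  let ?e = "\<lambda>h. fps_nth (height_fps (Suc h)) (n - m) - fps_nth (height_fps h) (n - m)"
  have e: "?e h \<ge> 0" for h using height_fps_nth_mono[of h "Suc h"] by simp
  have "deepest_part n m \<le> (\<Sum>h=1..<n. ?e h * c)"
    unfolding deepest_part_def
  proof (intro sum_mono)
    fix h
    show "?e h * fps_nth (forest_fps h) m \<le> ?e h * c"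
    proof (cases "h < n - m")
      case False
      then have "?e h = 0" by (simp add: height_fps_nth_eq)
      then show ?thesis by simp
    qed (use e assms(2) in \<open>intro mult_left_mono\<close>)
  qed
  also have "\<dots> = (\<Sum>h=1..<n. ?e h) * c" by (simp add: sum_distrib_right)
  also have "(\<Sum>h=1..<n. ?e h) = fps_nth (height_fps n) (n - m) - fps_nth (height_fps 1) (n - m)"
    using assms(1) by (rule sum_height_fps_diff)
  also have "(fps_nth (height_fps n) (n - m) - fps_nth (height_fps 1) (n - m)) * c
      \<le> num_trees (n - m) * c"
    using height_fps_nth_nonneg[of 1 "n - m"] height_fps_nth_le[of n "n - m"] assms(3)
    by (intro mult_right_mono) linarith+
  finally show ?thesis .
qed

lemma total_deepest_lower:
  assumes "n > K" "n \<ge> 2"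
  shows "total_deepest n \<ge> (\<Sum>m\<le>K. (num_trees (n - m) - fps_nth (height_fps (Suc m)) (n - m)) *
    num_forests m)"
proof -
  have "(\<Sum>m\<le>K. (num_trees (n - m) - fps_nth (height_fps (Suc m)) (n - m)) *
    num_forests m) \<le> (\<Sum>m\<le>K. deepest_part n m)"
    using assms by (intro sum_mono deepest_part_lower) auto
  also have "\<dots> \<le> (\<Sum>m\<le>n. deepest_part n m)"
    using assms by (intro sum_mono2 deepest_part_nonneg) auto
  finally show ?thesis using total_deepest_eq[OF assms(2)] by simp
qed

lemma all_forest_fps_nth:
  assumes "n \<ge> 1"
  shows "num_forests n = (\<Sum>k\<le>n. num_trees k * num_forests (n - k))"
proof -
  have "all_forest_fps = 1 + tree_fps weight * all_forest_fps"
    using all_forest_fps_eq by (simp add: mult.commute)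
  then have "num_forests n = fps_nth (1 + tree_fps weight * all_forest_fps) n" by simp
  then show ?thesis using assms by (simp add: fps_mult_nth atLeast0AtMost)
qed

text \<open>If the first factor has size k, only heights h < k matter. For k <= K the forest
  coefficient is at most that for height K; for k > K it is at most
  \<open>num_forests (n - k)\<close>, and these terms form the tail of the convolution for
  \<open>num_forests n\<close>.\<close>

lemma total_deepest_upper:
  assumes "n \<ge> K" "n \<ge> 2"
  shows "total_deepest n \<le> num_forests n
    - (\<Sum>k\<le>K. num_trees k * num_forests (n - k))
    + (\<Sum>k\<le>K. num_trees k * fps_nth (forest_fps K) (n - k))"
proof -
  let ?b = "\<lambda>k. num_trees k * num_forests (n - k)"
  have split: "(\<Sum>k\<le>n. c k) = (\<Sum>k\<le>K. c k) + (\<Sum>k\<in>{K<..n}. c k)" for c :: "nat \<Rightarrow> real"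
    using assms by (subst sum.union_disjoint[symmetric]) (auto intro: sum.cong)
  have "total_deepest n = (\<Sum>k\<le>n. deepest_part n (n - k))"
    unfolding total_deepest_eq[OF assms(2)]
    by (rule sum.reindex_bij_witness[of _ "\<lambda>k. n - k" "\<lambda>k. n - k"]) auto
  also have "\<dots> = (\<Sum>k\<le>K. deepest_part n (n - k)) + (\<Sum>k\<in>{K<..n}. deepest_part n (n - k))"
    by (rule split)
  also have "(\<Sum>k\<le>K. deepest_part n (n - k)) \<le>
      (\<Sum>k\<le>K. num_trees k * fps_nth (forest_fps K) (n - k))"
  proof (intro sum_mono)
    fix k assume "k \<in> {..K}"
    then show "deepest_part n (n - k) \<le> num_trees k * fps_nth (forest_fps K) (n - k)"
      using deepest_part_upper[of n "n - k" "fps_nth (forest_fps K) (n - k)"] assms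
      by (simp add: forest_fps_nth_nonneg forest_fps_nth_mono)
  qed
  also have "(\<Sum>k\<in>{K<..n}. deepest_part n (n - k)) \<le> (\<Sum>k\<in>{K<..n}. ?b k)"
  proof (intro sum_mono)
    fix k assume "k \<in> {K<..n}"
    then show "deepest_part n (n - k) \<le> ?b k"
      using deepest_part_upper[of n "n - k" "num_forests (n - k)"] assms
      by (simp add: forest_fps_nth_le all_forest_fps_nth_nonneg)
  qed
  also have "(\<Sum>k\<in>{K<..n}. ?b k) = num_forests n - (\<Sum>k\<le>K. ?b k)"
    using split[of ?b] all_forest_fps_nth[of n] assms by simp
  finally show ?thesis by simp
qed

subsection \<open>Asymptotics\<close>

text \<open>Eliminating the forest series gives F^2 - (1 - X) F + X - X^2 = 0; this is its completed
  square. The discriminant (1 - X)(1 - 5 X) reveals the singularity 1/5.\<close>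

lemma weight_fps_quadratic:
  "(1 - fps_X - 2 * tree_fps weight)\<^sup>2 = 1 - 6 * fps_X + 5 * fps_X\<^sup>2"
  using weight_fps_forest all_forest_fps_eq by algebra

lemma all_forest_fps_nth_0: "num_forests 0 = 1"
proof -
  have "num_forests 0 = fps_nth (1 + all_forest_fps * tree_fps weight) 0"
    using all_forest_fps_eq by simp
  then show ?thesis by (simp add: tree_fps_nth_0)
qed

lemma num_trees_Suc_Suc: "num_trees (Suc (Suc n)) = 2 * num_forests (Suc n) - num_forests n"
proof -
  have "tree_fps weight = fps_X * (all_forest_fps * 2 - fps_X * all_forest_fps) - fps_X"
    using weight_fps_forest by (simp add: algebra_simps)
  then have "num_trees (Suc (Suc n)) = fps_nth (fps_X * (all_forest_fps * 2 - fps_X * all_forest_fps) - fps_X) (Suc (Suc n))"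
    by (rule arg_cong)
  then show ?thesis by (simp add: numeral_fps_const)
qed

lemma num_trees_1: "num_trees 1 = 1"
proof -
  have "tree_fps weight = fps_X * (all_forest_fps * 2 - fps_X * all_forest_fps) - fps_X"
    using weight_fps_forest by (simp add: algebra_simps)
  then have "num_trees 1 = fps_nth (fps_X * (all_forest_fps * 2 - fps_X * all_forest_fps) - fps_X) 1"
    by (rule arg_cong)
  then show ?thesis by (simp add: numeral_fps_const all_forest_fps_nth_0)
qed

lemma num_trees_2: "num_trees (Suc (Suc 0)) = 1"
  using all_forest_fps_nth[of 1] num_trees_1
  by (simp add: num_trees_Suc_Suc all_forest_fps_nth_0 tree_fps_nth_0)

text \<open>
  The linear recurrence comes from the differential equation
  \<open>(1 - 6 X + 5 X\<^sup>2) W' = (5 X - 3) W\<close> of the square root \<open>W = 1 - X - 2 F\<close>.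
\<close>

lemma num_trees_recurrence:
  "real (n + 3) * num_trees (n + 3) = real (6 * n + 9) * num_trees (n + 2) - real (5 * n) * num_trees (n + 1)"
proof -
  define W where "W = 1 - fps_X - 2 * tree_fps weight"
  have W2: "W * W = 1 - 6 * fps_X + 5 * fps_X\<^sup>2"
    using weight_fps_quadratic by (simp add: W_def power2_eq_square)
  have "fps_deriv (W * W) = fps_deriv (1 - 6 * fps_X + 5 * fps_X\<^sup>2)"
    using W2 by simp
  then have "2 * (W * fps_deriv W) = 2 * (5 * fps_X - 3)"
    by (simp add: numeral_fps_const algebra_simps power2_eq_square)
  moreover have "(2 :: real fps) \<noteq> 0"
    by (simp add: numeral_fps_const)
  ultimately have d: "W * fps_deriv W = 5 * fps_X - 3"
    by (metis mult_left_cancel)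
  \<comment> \<open>Allows W to be cancelled after the equation for W W' is multiplied by W, which
    makes the known quadratic W^2 appear.\<close>
  have "W \<noteq> 0"
  proof
    assume "W = 0"
    then have "fps_nth W 0 = 0" by simp
    then show False by (simp add: W_def tree_fps_nth_0 numeral_fps_const)
  qed
  moreover have "W * ((W * W) * fps_deriv W) = W * (W * (5 * fps_X - 3))"
    using d by algebra
  ultimately have "(W * W) * fps_deriv W = W * (5 * fps_X - 3)" by simp
  then have ode: "fps_deriv W - fps_const 6 * (fps_X * fps_deriv W) + fps_const 5 * (fps_X * (fps_X * fps_deriv W)) =
      fps_const 5 * (fps_X * W) - fps_const 3 * W"
    unfolding W2 by (simp add: numeral_fps_const algebra_simps power2_eq_square)
  have w: "fps_nth W (Suc (Suc k)) = - 2 * num_trees (Suc (Suc k))" for k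
    by (simp add: W_def numeral_fps_const)
  have w1: "fps_nth W (Suc 0) = - 3"
    using num_trees_1 by (simp add: W_def numeral_fps_const)
  have "fps_nth (fps_deriv W - fps_const 6 * (fps_X * fps_deriv W) + fps_const 5 * (fps_X * (fps_X * fps_deriv W))) (Suc (Suc n)) =
      fps_nth (fps_const 5 * (fps_X * W) - fps_const 3 * W) (Suc (Suc n))"
    unfolding ode ..
  then have "real (n + 3) * fps_nth W (n + 3) - 6 * real (n + 2) * fps_nth W (n + 2) + 5 * real (n + 1) * fps_nth W (n + 1)
     = 5 * fps_nth W (n + 1) - 3 * fps_nth W (n + 2)"
    by (simp add: numeral_3_eq_3 algebra_simps)
  then have "real (n + 3) * fps_nth W (n + 3) =
     real (6 * n + 9) * fps_nth W (n + 2) - real (5 * n) * fps_nth W (n + 1)"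
    by (simp add: algebra_simps)
  \<comment> \<open>For n = 0 the coefficient of W at 1 is not -2 times a tree number, but its
    factor 5 n is zero.\<close>
  then show ?thesis
    by (cases n) (simp_all add: w w1 numeral_3_eq_3 numeral_2_eq_2)
qed

text \<open>Each bound reproduces itself when inserted for \<open>num_trees (n + 1)\<close> in the
  recurrence: the coefficient becomes 5 n + 9 <= 5 (n + 3) for the upper and 5 n + 7 >= 5 (n + 1)
  for the lower one.\<close>

lemma num_trees_ratio_bounds:
  "real (5 * n) * num_trees (n + 1) \<le> real (n + 2) * num_trees (n + 2) \<and>
   num_trees (n + 2) \<le> 5 * num_trees (n + 1)"
proof (induction n)
  case 0
  then show ?case using num_trees_1 num_trees_2 by (simp add: numeral_2_eq_2)
next
  case (Suc n)
  let ?a = "num_trees (n + 1)" and ?b = "num_trees (n + 2)" and ?c = "num_trees (n + 3)"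
  have pos: "?b \<ge> 0" by (rule weight_fps_nth_nonneg)
  have rec: "real (n + 3) * ?c = real (6 * n + 9) * ?b - real (5 * n) * ?a"
    by (rule num_trees_recurrence)
  have "real n * ?b \<le> real n * (5 * ?a)"
    using Suc.IH by (intro mult_left_mono) auto
  then have "real (n + 3) * ?c \<le> real (6 * n + 9) * ?b - real n * ?b"
    using rec by simp
  also have "\<dots> \<le> real (n + 3) * (5 * ?b)"
    using pos by (simp add: algebra_simps)
  finally have up: "?c \<le> 5 * ?b"
    by (rule mult_left_le_imp_le) simp
  have "real (5 * Suc n) * ?b \<le> real (6 * n + 9) * ?b - real (n + 2) * ?b"
    using pos by (simp add: algebra_simps)
  also have "\<dots> \<le> real (n + 3) * ?c"
    using rec Suc.IH by simp
  finally show ?case using up by (simp add: eval_nat_numeral)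
qed

lemma num_trees_ratio: "(\<lambda>n. num_trees (Suc n) / num_trees n) \<longlonglongrightarrow> 5"
proof (subst filterlim_sequentially_Suc[symmetric], rule tendsto_sandwich)
  have pos: "num_trees (Suc n) > 0" for n by (rule weight_fps_nth_pos) simp
  show "\<forall>\<^sub>F n in sequentially. 5 * real n / real (n + 2) \<le> num_trees (Suc (Suc n)) / num_trees (Suc n)"
  proof (rule always_eventually, rule allI)
    fix n
    show "5 * real n / real (n + 2) \<le> num_trees (Suc (Suc n)) / num_trees (Suc n)"
      using num_trees_ratio_bounds[of n] pos[of n] by (simp add: field_simps)
  qed
  show "\<forall>\<^sub>F n in sequentially. num_trees (Suc (Suc n)) / num_trees (Suc n) \<le> 5"
  proof (rule always_eventually, rule allI)
    fix n
    show "num_trees (Suc (Suc n)) / num_trees (Suc n) \<le> 5"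
      using num_trees_ratio_bounds[of n] pos[of n] by (simp add: field_simps)
  qed
  show "(\<lambda>n. 5 * real n / real (n + 2)) \<longlonglongrightarrow> 5" by real_asymp
qed simp

lemma num_trees_shift_ratio: "(\<lambda>n. num_trees (n - m) / num_trees n) \<longlonglongrightarrow> (1 / 5) ^ m"
proof (induction m)
  case 0
  have "\<forall>\<^sub>F n in sequentially. num_trees (n - 0) / num_trees n = 1"
    using eventually_ge_at_top[of 1] by eventually_elim (use weight_fps_nth_pos in force)
  then show ?case by (simp add: tendsto_eventually)
next
  case (Suc m)
  have "(\<lambda>n. inverse (num_trees (Suc n) / num_trees n)) \<longlonglongrightarrow> inverse 5"
    by (intro tendsto_inverse num_trees_ratio) simp
  then have "(\<lambda>n. (num_trees (n - m) / num_trees n) * inverse (num_trees (Suc n) / num_trees n)) \<longlonglongrightarrow> (1 / 5) ^ m * inverse 5"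
    by (intro tendsto_mult Suc.IH)
  moreover have "\<forall>\<^sub>F n in sequentially. (num_trees (n - m) / num_trees n) * inverse (num_trees (Suc n) / num_trees n)
      = num_trees (Suc n - Suc m) / num_trees (Suc n)"
    using eventually_ge_at_top[of 1]
    by eventually_elim (use weight_fps_nth_pos in \<open>force simp: field_simps\<close>)
  ultimately have "(\<lambda>n. num_trees (Suc n - Suc m) / num_trees (Suc n)) \<longlonglongrightarrow> (1 / 5) ^ m * inverse 5"
    by (rule Lim_transform_eventually)
  then show ?case
    by (subst filterlim_sequentially_Suc[symmetric]) (simp add: field_simps)
qed

text \<open>The limit is the fixed point of y = c' + d' y; the distance to it eventually contracts
  by a factor below 1, up to an arbitrarily small error.\<close>

lemma tendsto_affine_recurrence:
  fixes x c d :: "nat \<Rightarrow> real"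
  assumes rec: "\<forall>\<^sub>F n in sequentially. x (Suc n) = c n + d n * x n"
    and c: "c \<longlonglongrightarrow> c'" and d: "d \<longlonglongrightarrow> d'" and d': "\<bar>d'\<bar> < 1"
  shows "x \<longlonglongrightarrow> c' / (1 - d')"
proof -
  define L where "L = c' / (1 - d')"
  define \<theta> where "\<theta> = (1 + \<bar>d'\<bar>) / 2"
  have \<theta>: "\<bar>d'\<bar> < \<theta>" "\<theta> < 1" "0 < \<theta>" using d' by (auto simp: \<theta>_def)
  have "c' + d' * L - L = 0" using d' by (simp add: L_def field_simps)
  moreover have "(\<lambda>n. c n + d n * L - L) \<longlonglongrightarrow> c' + d' * L - L"
    by (intro tendsto_intros c d)
  ultimately have e0: "(\<lambda>n. c n + d n * L - L) \<longlonglongrightarrow> 0" by simp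
  have "(\<lambda>n. \<bar>d n\<bar>) \<longlonglongrightarrow> \<bar>d'\<bar>" by (intro tendsto_intros d)
  then have d_le: "\<forall>\<^sub>F n in sequentially. \<bar>d n\<bar> < \<theta>" using \<theta>(1) by (rule order_tendstoD)
  have "x \<longlonglongrightarrow> L"
  proof (rule tendstoI)
    fix \<epsilon> :: real assume \<epsilon>: "\<epsilon> > 0"
    \<comment> \<open>Chosen so that
      \<open>\<theta> * (\<epsilon> / 2) + \<delta> = \<epsilon> / 2\<close>, which makes the bound
      below inductive.\<close>
    define \<delta> where "\<delta> = \<epsilon> * (1 - \<theta>) / 2"
    have \<delta>: "\<delta> > 0" using \<epsilon> \<theta> by (simp add: \<delta>_def)
    have "\<forall>\<^sub>F n in sequentially. \<bar>c n + d n * L - L\<bar> < \<delta>"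
      using tendstoD[OF e0 \<delta>] by (simp add: dist_real_def)
    with rec d_le have "\<forall>\<^sub>F n in sequentially. \<bar>x (Suc n) - L\<bar> \<le> \<theta> * \<bar>x n - L\<bar> + \<delta>"
    proof eventually_elim
      case (elim n)
      have "\<bar>x (Suc n) - L\<bar> = \<bar>(c n + d n * L - L) + d n * (x n - L)\<bar>"
        using elim by (simp add: algebra_simps)
      also have "\<dots> \<le> \<bar>c n + d n * L - L\<bar> + \<bar>d n\<bar> * \<bar>x n - L\<bar>"
        by (metis abs_mult abs_triangle_ineq)
      also have "\<dots> \<le> \<delta> + \<theta> * \<bar>x n - L\<bar>"
        using elim by (intro add_mono mult_right_mono) auto
      finally show ?case by simp
    qed
    then obtain N where N: "\<And>n. n \<ge> N \<Longrightarrow> \<bar>x (Suc n) - L\<bar> \<le> \<theta> * \<bar>x n - L\<bar> + \<delta>"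
      unfolding eventually_sequentially by blast
    have bound: "\<bar>x (N + k) - L\<bar> \<le> \<theta> ^ k * \<bar>x N - L\<bar> + \<epsilon> / 2" for k
    proof (induction k)
      case (Suc k)
      have "\<bar>x (N + Suc k) - L\<bar> \<le> \<theta> * \<bar>x (N + k) - L\<bar> + \<delta>" using N[of "N + k"] by simp
      also have "\<dots> \<le> \<theta> * (\<theta> ^ k * \<bar>x N - L\<bar> + \<epsilon> / 2) + \<delta>"
        using Suc \<theta> by (intro add_right_mono mult_left_mono) auto
      also have "\<dots> = \<theta> ^ Suc k * \<bar>x N - L\<bar> + \<epsilon> / 2" by (simp add: \<delta>_def field_simps)
      finally show ?case .
    qed (use \<epsilon> in simp)
    have "(\<lambda>k. \<theta> ^ k * \<bar>x N - L\<bar>) \<longlonglongrightarrow> 0 * \<bar>x N - L\<bar>"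
      using \<theta> by (intro tendsto_mult tendsto_const LIMSEQ_power_zero) auto
    then have "\<forall>\<^sub>F k in sequentially. \<theta> ^ k * \<bar>x N - L\<bar> < \<epsilon> / 2"
      using \<epsilon> by (intro order_tendstoD(2)) auto
    then have "\<forall>\<^sub>F k in sequentially. dist (x (N + k)) L < \<epsilon>"
    proof eventually_elim
      case (elim k)
      then show ?case using bound[of k] by (simp add: dist_real_def)
    qed
    then show "\<forall>\<^sub>F n in sequentially. dist (x n) L < \<epsilon>"
      using eventually_sequentially_seg[of "\<lambda>n. dist (x n) L < \<epsilon>" N] by (simp add: add.commute)
  qed
  then show ?thesis by (simp add: L_def)
qed

text \<open>Dividing \<open>num_trees_Suc_Suc\<close> by \<open>2 * num_trees (Suc n)\<close> gives
  an affine recurrence whose coefficients tend to 5/2 and 1/10.\<close>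

lemma num_forests_ratio: "(\<lambda>n. num_forests n / num_trees n) \<longlonglongrightarrow> 25 / 9"
proof -
  have "\<forall>\<^sub>F n in sequentially. num_forests (Suc n) / num_trees (Suc n) =
     (num_trees (Suc (Suc n)) / num_trees (Suc n)) / 2
     + (num_trees (Suc n - 1) / num_trees (Suc n)) / 2 * (num_forests n / num_trees n)"
    using eventually_ge_at_top[of 1]
  proof eventually_elim
    case (elim n)
    then have "num_trees n > 0" "num_trees (Suc n) > 0" using weight_fps_nth_pos by auto
    then show ?case using num_trees_Suc_Suc[of n] by (simp add: field_simps)
  qed
  moreover have "(\<lambda>n. num_trees (Suc (Suc n)) / num_trees (Suc n) / 2) \<longlonglongrightarrow> 5 / 2"
    using num_trees_ratio by (subst (asm) filterlim_sequentially_Suc[symmetric]) (intro tendsto_divide, auto)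
  moreover have "(\<lambda>n. (num_trees (Suc n - 1) / num_trees (Suc n)) / 2) \<longlonglongrightarrow> (1 / 5) ^ 1 / 2"
    using num_trees_shift_ratio[of 1]
    by (subst (asm) filterlim_sequentially_Suc[symmetric]) (intro tendsto_divide, auto)
  ultimately have "(\<lambda>n. num_forests n / num_trees n) \<longlonglongrightarrow> (5 / 2) / (1 - (1 / 5) ^ 1 / 2)"
    by (rule tendsto_affine_recurrence) simp
  then show ?thesis by simp
qed

section \<open>Absolutely convergent evaluation of power series\<close>

definition abs_sums :: "real fps \<Rightarrow> real \<Rightarrow> real \<Rightarrow> bool" where
  "abs_sums F x v \<longleftrightarrow> summable (\<lambda>n. \<bar>fps_nth F n * x ^ n\<bar>) \<and> (\<lambda>n. fps_nth F n * x ^ n) sums v"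

lemma abs_sums_diff:
  assumes "abs_sums F x u" "abs_sums G x v"
  shows "abs_sums (F - G) x (u - v)"
  unfolding abs_sums_def
proof
  have "summable (\<lambda>n. \<bar>fps_nth F n * x ^ n\<bar> + \<bar>fps_nth G n * x ^ n\<bar>)"
    using assms by (intro summable_add) (auto simp: abs_sums_def)
  then show "summable (\<lambda>n. \<bar>fps_nth (F - G) n * x ^ n\<bar>)"
    by (rule summable_comparison_test') (simp add: left_diff_distrib abs_triangle_ineq4)
  show "(\<lambda>n. fps_nth (F - G) n * x ^ n) sums (u - v)"
    using assms sums_diff by (fastforce simp: abs_sums_def left_diff_distrib)
qed

text \<open>Absolute convergence is built into \<open>abs_sums\<close> for the sake of this Cauchy
  product.\<close>

lemma abs_sums_mult:
  assumes "abs_sums F x u" "abs_sums G x v"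
  shows "abs_sums (F * G) x (u * v)"
  unfolding abs_sums_def
proof
  let ?f = "\<lambda>n. fps_nth F n * x ^ n" and ?g = "\<lambda>n. fps_nth G n * x ^ n"
  have abs: "summable (\<lambda>n. norm (?f n))" "summable (\<lambda>n. norm (?g n))"
    and sums: "?f sums u" "?g sums v"
    using assms by (auto simp: abs_sums_def)
  have nth: "fps_nth (F * G) n * x ^ n = (\<Sum>i\<le>n. ?f i * ?g (n - i))" for n
    by (simp add: fps_mult_nth sum_distrib_right atLeast0AtMost)
       (intro sum.cong refl, simp add: power_add[symmetric] mult.assoc mult.left_commute)
  show "(\<lambda>n. fps_nth (F * G) n * x ^ n) sums (u * v)"
    unfolding nth using Cauchy_product_sums[OF abs] sums by (simp add: sums_unique[symmetric])
  have "summable (\<lambda>n. \<Sum>i\<le>n. norm (?f i) * norm (?g (n - i)))"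
    using abs by (intro summable_Cauchy_product) simp_all
  then show "summable (\<lambda>n. \<bar>fps_nth (F * G) n * x ^ n\<bar>)"
    by (rule summable_comparison_test') (unfold nth, auto intro!: order.trans[OF sum_abs] sum_mono simp: abs_mult)
qed

lemma abs_sums_finite:
  assumes "finite A" "\<And>n. n \<notin> A \<Longrightarrow> fps_nth F n = 0"
  shows "abs_sums F x (\<Sum>n\<in>A. fps_nth F n * x ^ n)"
  unfolding abs_sums_def
  using assms by (intro conjI summable_finite[of A] sums_finite) auto

lemma abs_sums_X: "abs_sums fps_X x x"
  using abs_sums_finite[of "{1}" fps_X x] by simp

lemma abs_sums_const: "abs_sums (fps_const c) x c"
  using abs_sums_finite[of "{0}" "fps_const c" x] by simp

lemma abs_sums_nonneg:
  assumes "\<And>n. fps_nth F n \<ge> 0" "x \<ge> 0" "\<And>N. (\<Sum>n<N. fps_nth F n * x ^ n) \<le> c"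
  obtains v where "abs_sums F x v" "v \<le> c"
proof -
  have "summable (\<lambda>n. fps_nth F n * x ^ n)"
    using assms by (intro summableI_nonneg_bounded[of _ c]) auto
  then show ?thesis
    using that[of "\<Sum>n. fps_nth F n * x ^ n"] assms suminf_le_const[of "\<lambda>n. fps_nth F n * x ^ n" c]
    by (simp add: abs_sums_def abs_mult summable_sums)
qed

lemma abs_sums_partial:
  assumes "\<And>n. fps_nth F n \<ge> 0" "x \<ge> 0" "abs_sums F x v" "finite A"
  shows "(\<Sum>n\<in>A. fps_nth F n * x ^ n) \<le> v"
  using assms sum_le_suminf[of "\<lambda>n. fps_nth F n * x ^ n" A]
  by (simp add: abs_sums_def sums_iff)

lemma abs_sums_unique: "abs_sums F x u \<Longrightarrow> abs_sums F x v \<Longrightarrow> u = v"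
  unfolding abs_sums_def using sums_unique2 by blast

lemma abs_sums_smaller:
  assumes "\<And>n. fps_nth F n \<ge> 0" "abs_sums F x v" "0 \<le> y" "y \<le> x"
  obtains u where "abs_sums F y u" "u \<le> v"
proof (rule abs_sums_nonneg[of F y v])
  fix N
  have "(\<Sum>n<N. fps_nth F n * y ^ n) \<le> (\<Sum>n<N. fps_nth F n * x ^ n)"
    using assms by (intro sum_mono mult_left_mono power_mono) auto
  also have "\<dots> \<le> v" using assms by (intro abs_sums_partial) auto
  finally show "(\<Sum>n<N. fps_nth F n * y ^ n) \<le> v" .
qed (use assms that in auto)

text \<open>The triangle i + j < N lies in a square, so the partial sums p of G satisfy p <= 1 + p s
  and are bounded. Once G converges, G - G F = 1 determines its value.\<close>

lemma abs_sums_geometric: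
  assumes "\<And>n. fps_nth F n \<ge> 0" "\<And>n. fps_nth G n \<ge> 0" "G = 1 + G * F" "x \<ge> 0"
    "abs_sums F x s" "s < 1" 
  shows "abs_sums G x (1 / (1 - s))"
proof -
  let ?p = "\<lambda>N. \<Sum>n<N. fps_nth G n * x ^ n"
  have F0: "s \<ge> 0" using abs_sums_partial[of F x s "{}"] assms by simp
  have "?p N \<le> 1 / (1 - s)" for N
  proof -
    have "fps_nth G n * x ^ n = of_bool (n = 0) + (\<Sum>i\<le>n. (fps_nth G i * x ^ i) * (fps_nth F (n - i) * x ^ (n - i)))" for n
    proof -
      have "fps_nth G n * x ^ n = fps_nth (1 + G * F) n * x ^ n" using assms(3) by simp
      also have "\<dots> = of_bool (n = 0) + (\<Sum>i\<le>n. fps_nth G i * fps_nth F (n - i) * x ^ n)"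
        by (simp add: fps_mult_nth sum_distrib_right distrib_right atLeast0AtMost)
      also have "(\<Sum>i\<le>n. fps_nth G i * fps_nth F (n - i) * x ^ n) =
          (\<Sum>i\<le>n. (fps_nth G i * x ^ i) * (fps_nth F (n - i) * x ^ (n - i)))"
        by (intro sum.cong refl) (simp add: power_add[symmetric] mult.assoc mult.left_commute)
      finally show ?thesis .
    qed
    then have "?p N = (\<Sum>n<N. of_bool (n = 0) +
        (\<Sum>i\<le>n. (fps_nth G i * x ^ i) * (fps_nth F (n - i) * x ^ (n - i))))"
      by (intro sum.cong refl)
    also have "\<dots> = (\<Sum>n<N. of_bool (n = 0)) +
        (\<Sum>n<N. \<Sum>i\<le>n. (fps_nth G i * x ^ i) * (fps_nth F (n - i) * x ^ (n - i)))"
      by (rule sum.distrib)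
    also have "(\<Sum>n<N. \<Sum>i\<le>n. (fps_nth G i * x ^ i) * (fps_nth F (n - i) * x ^ (n - i)))
      = (\<Sum>(i, j)\<in>{(i, j). i + j < N}. (fps_nth G i * x ^ i) * (fps_nth F j * x ^ j))"
      by (rule sum.triangle_reindex[symmetric])
    also have "\<dots> \<le> (\<Sum>(i, j)\<in>{..<N} \<times> {..<N}. (fps_nth G i * x ^ i) * (fps_nth F j * x ^ j))"
      using assms by (intro sum_mono2) auto
    also have "\<dots> = ?p N * (\<Sum>j<N. fps_nth F j * x ^ j)"
      by (simp add: sum_product sum.cartesian_product)
    also have "\<dots> \<le> ?p N * s"
      using assms by (intro mult_left_mono abs_sums_partial sum_nonneg) auto
    also have "(\<Sum>n<N. of_bool (n = 0) :: real) \<le> 1"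
      by (cases N) (simp_all del: sum.lessThan_Suc add: sum.lessThan_Suc_shift)
    finally show ?thesis using assms by (simp add: field_simps)
  qed
  then obtain v where v: "abs_sums G x v"
    using abs_sums_nonneg[of G x "1 / (1 - s)"] assms by blast
  have "abs_sums (G - G * F) x (v - v * s)"
    by (intro abs_sums_diff abs_sums_mult v assms)
  moreover have "G - G * F = fps_const 1" using assms(3) by (simp add: algebra_simps)
  ultimately have "v - v * s = 1" using abs_sums_const[of 1 x] abs_sums_unique by metis
  then have "v = 1 / (1 - s)" using assms by (simp add: field_simps)
  then show ?thesis using v by simp
qed

text \<open>At X = 1/5 the recursion map F -> X (2 - X) / (1 - F) - X has the fixed point 2/5 and is
  increasing below it, so values below 2/5 stay there. Continuity then provides a point to the right
  of 1/5.\<close>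

lemma height_fps_sums:
  assumes "h \<ge> 1"
  shows "\<exists>x s. x > 1 / 5 \<and> s < 2 / 5 \<and> abs_sums (height_fps h) x s"
  using assms
proof (induction h rule: dec_induct)
  case base
  \<comment> \<open>Any point strictly between 1/5 and 2/5 serves, as F_1 = X.\<close>
  show ?case using abs_sums_X[of "3 / 10"] by (intro exI[of _ "3 / 10"]) (simp add: height_fps_1[simplified])
next
  case (step h)
  then obtain x s where x: "x > 1 / 5" "s < 2 / 5" "abs_sums (height_fps h) x s" by blast
  let ?\<phi> = "\<lambda>y. y * (2 - y) * (1 / (1 - s)) - y"
  have "isCont ?\<phi> (1 / 5)" by (intro continuous_intros)
  then have "(?\<phi> \<longlongrightarrow> ?\<phi> (1 / 5)) (at_right (1 / 5))"
    by (meson continuous_at_imp_continuous_at_within continuous_within)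
  moreover have "?\<phi> (1 / 5) < 2 / 5" using x(2) by (simp add: field_simps)
  ultimately have "\<forall>\<^sub>F y in at_right (1 / 5). ?\<phi> y < 2 / 5" by (rule order_tendstoD)
  moreover have "\<forall>\<^sub>F y in at_right (1 / 5). y \<in> {1 / 5<..<min x 2}"
    using x(1) by (intro eventually_at_right_real) simp
  ultimately have "\<forall>\<^sub>F y in at_right (1 / 5). ?\<phi> y < 2 / 5 \<and> y \<in> {1 / 5<..<min x 2}"
    by eventually_elim simp
  then obtain y where y: "?\<phi> y < 2 / 5" "1 / 5 < y" "y < x" "y < 2"
    using eventually_happens'[of "at_right (1 / 5 :: real)"] by fastforce
  \<comment> \<open>Moving from x to the smaller y can only lower the value of F_h, and the
    recursion map is increasing in that value.\<close>
  obtain u where u: "abs_sums (height_fps h) y u" "u \<le> s"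
    using abs_sums_smaller[OF height_fps_nth_nonneg x(3), of y] y by auto
  have "abs_sums (forest_fps h) y (1 / (1 - u))"
    using u x(2) y
    by (intro abs_sums_geometric[OF height_fps_nth_nonneg forest_fps_nth_nonneg forest_fps_eq]) auto
  then have "abs_sums (fps_X * (fps_const 2 - fps_X) * forest_fps h - fps_X) y (y * (2 - y) * (1 / (1 - u)) - y)"
    by (intro abs_sums_diff abs_sums_mult abs_sums_X abs_sums_const)
  then have "abs_sums (height_fps (Suc h)) y (y * (2 - y) * (1 / (1 - u)) - y)"
    using height_fps_Suc_forest[OF step.hyps(1)] by (simp add: numeral_fps_const)
  moreover have "y * (2 - y) * (1 / (1 - u)) \<le> y * (2 - y) * (1 / (1 - s))"
    using u x(2) y by (intro mult_left_mono divide_left_mono mult_nonneg_nonneg) auto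
  then have "y * (2 - y) * (1 / (1 - u)) - y < 2 / 5" using y(1) by linarith
  ultimately show ?case using y(2) by blast
qed

lemma forest_fps_sums:
  assumes "h \<ge> 1"
  shows "\<exists>x v. x > 1 / 5 \<and> abs_sums (forest_fps h) x v"
proof -
  obtain x s where "x > 1 / 5" "s < 2 / 5" "abs_sums (height_fps h) x s"
    using height_fps_sums[OF assms] by blast
  then show ?thesis
    using abs_sums_geometric[OF height_fps_nth_nonneg forest_fps_nth_nonneg forest_fps_eq, of x h s] by auto
qed

text \<open>The ratio of tree numbers tends to 5 > 1 / x, so \<open>num_trees n * x ^ n\<close> is
  eventually increasing and bounded away from 0, whereas the terms of a convergent series tend to
  0.\<close>

lemma abs_sums_negligible:
  assumes "abs_sums F x v" "x > 1 / 5"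
  shows "(\<lambda>n. fps_nth F n / num_trees n) \<longlonglongrightarrow> 0"
proof -
  have "(\<lambda>n. num_trees (Suc n) / num_trees n * x) \<longlonglongrightarrow> 5 * x"
    by (intro tendsto_intros num_trees_ratio)
  then have "\<forall>\<^sub>F n in sequentially. 1 < num_trees (Suc n) / num_trees n * x"
    by (rule order_tendstoD(1)) (use assms(2) in simp)
  then obtain N where N: "\<And>n. n \<ge> N \<Longrightarrow> 1 < num_trees (Suc n) / num_trees n * x"
    unfolding eventually_sequentially by blast
  define M where "M = max 1 N"
  define c where "c = num_trees M * x ^ M"
  have x: "x > 0" using assms(2) by simp
  have c: "c > 0" using weight_fps_nth_pos[of M] x by (simp add: c_def M_def)
  have low: "num_trees n * x ^ n \<ge> c" if "n \<ge> M" for n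
    using that
  proof (induction n rule: dec_induct)
    case (step n)
    have pos: "num_trees n > 0" using step.hyps weight_fps_nth_pos[of n] by (simp add: M_def)
    then have "num_trees n \<le> num_trees (Suc n) * x"
      using N[of n] step.hyps by (simp add: M_def field_simps)
    then have "num_trees n * x ^ n \<le> num_trees (Suc n) * x * x ^ n"
      using x by (intro mult_right_mono) auto
    then show ?case using step.IH by (simp add: mult.assoc)
  qed (simp add: c_def)
  have "(\<lambda>n. \<bar>fps_nth F n * x ^ n\<bar>) \<longlonglongrightarrow> 0"
    using assms(1) by (intro summable_LIMSEQ_zero) (simp add: abs_sums_def)
  then have lim: "(\<lambda>n. \<bar>fps_nth F n * x ^ n\<bar> / c) \<longlonglongrightarrow> 0"
    using tendsto_divide[of _ 0 sequentially "\<lambda>_. c" c] c by simp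
  show ?thesis
  proof (rule Lim_null_comparison[OF _ lim])
    show "\<forall>\<^sub>F n in sequentially. norm (fps_nth F n / num_trees n) \<le> \<bar>fps_nth F n * x ^ n\<bar> / c"
      using eventually_ge_at_top[of M]
    proof eventually_elim
      case (elim n)
      have pos: "num_trees n > 0" using elim weight_fps_nth_pos[of n] by (simp add: M_def)
      have "norm (fps_nth F n / num_trees n) = \<bar>fps_nth F n * x ^ n\<bar> / (num_trees n * x ^ n)"
        using pos x by (simp add: abs_mult)
      also have "\<dots> \<le> \<bar>fps_nth F n * x ^ n\<bar> / c"
        using low[OF elim] c by (intro divide_left_mono) auto
      finally show ?case .
    qed
  qed
qed

text \<open>The value of the tree series at its singularity is the double root \<open>2 / 5\<close> of a quadratic.\<close>

lemma num_sums:
  shows "(\<lambda>n. num_trees n * (1 / 5) ^ n) sums (2 / 5)"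
    and "(\<lambda>n. num_forests n * (1 / 5) ^ n) sums (5 / 3)"
proof -
  \<comment> \<open>The coefficients below N are those of \<open>height_fps (Suc N)\<close>, whose
    value at 1/5 is below 2/5.\<close>
  have "(\<Sum>n<N. num_trees n * (1 / 5) ^ n) \<le> 2 / 5" for N
  proof -
    obtain x s where x: "x > 1 / 5" "s < 2 / 5" "abs_sums (height_fps (Suc N)) x s"
      using height_fps_sums[of "Suc N"] by auto
    obtain u where u: "abs_sums (height_fps (Suc N)) (1 / 5) u" "u \<le> s"
      using abs_sums_smaller[OF height_fps_nth_nonneg x(3), of "1 / 5"] x(1) by auto
    have "(\<Sum>n<N. num_trees n * (1 / 5) ^ n) = (\<Sum>n<N. fps_nth (height_fps (Suc N)) n * (1 / 5) ^ n)"
      by (intro sum.cong) (auto simp: height_fps_nth_eq)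
    also have "\<dots> \<le> u" using u by (intro abs_sums_partial height_fps_nth_nonneg) auto
    finally show ?thesis using u x by simp
  qed
  then obtain s where s: "abs_sums (tree_fps weight) (1 / 5) s" "s \<le> 2 / 5"
    using abs_sums_nonneg[of "tree_fps weight" "1 / 5" "2 / 5"] weight_fps_nth_nonneg by auto
  have G: "abs_sums all_forest_fps (1 / 5) (1 / (1 - s))"
    using s by (intro abs_sums_geometric[OF weight_fps_nth_nonneg all_forest_fps_nth_nonneg all_forest_fps_eq]) auto
  then have "abs_sums (fps_X * (fps_const 2 - fps_X) * all_forest_fps - fps_X) (1 / 5)
     (1 / 5 * (2 - 1 / 5) * (1 / (1 - s)) - 1 / 5)"
    by (intro abs_sums_diff abs_sums_mult abs_sums_X abs_sums_const)
  then have "abs_sums (tree_fps weight) (1 / 5) (1 / 5 * (2 - 1 / 5) * (1 / (1 - s)) - 1 / 5)"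
    using weight_fps_forest by (simp add: numeral_fps_const)
  then have "s = 1 / 5 * (2 - 1 / 5) * (1 / (1 - s)) - 1 / 5"
    using s(1) abs_sums_unique by blast
  then have "(s - 2 / 5)\<^sup>2 = 0"
    using s(2) by (simp add: field_simps power2_eq_square)
  then have s_eq: "s = 2 / 5" by simp
  show "(\<lambda>n. num_trees n * (1 / 5) ^ n) sums (2 / 5)" "(\<lambda>n. num_forests n * (1 / 5) ^ n) sums (5 / 3)"
    using s(1) G unfolding abs_sums_def s_eq by simp_all
qed

section \<open>Limits of both bounds relative to the number of trees\<close>

lemma shift_ratio:
  assumes "(\<lambda>n. c n / num_trees n) \<longlonglongrightarrow> L"
  shows "(\<lambda>n. c (n - k) / num_trees n) \<longlonglongrightarrow> L * (1 / 5) ^ k"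
proof -
  have "(\<lambda>n. c (n - k) / num_trees (n - k)) \<longlonglongrightarrow> L"
    by (rule filterlim_compose[OF assms filterlim_minus_const_nat_at_top])
  then have "(\<lambda>n. c (n - k) / num_trees (n - k) * (num_trees (n - k) / num_trees n)) \<longlonglongrightarrow> L * (1 / 5) ^ k"
    by (intro tendsto_mult num_trees_shift_ratio)
  moreover have "\<forall>\<^sub>F n in sequentially.
     c (n - k) / num_trees (n - k) * (num_trees (n - k) / num_trees n) = c (n - k) / num_trees n"
    using eventually_ge_at_top[of "Suc k"]
  proof eventually_elim
    case (elim n)
    then have "num_trees (n - k) > 0" by (intro weight_fps_nth_pos) simp
    then show ?case by simp
  qed
  ultimately show ?thesis by (rule Lim_transform_eventually)
qed

lemma deepest_ratio_lower:
  "(\<lambda>n. (\<Sum>m\<le>K. (num_trees (n - m) - fps_nth (height_fps (Suc m)) (n - m)) * num_forests m) / num_trees n)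
     \<longlonglongrightarrow> (\<Sum>m\<le>K. num_forests m * (1 / 5) ^ m)"
proof -
  have "(\<lambda>n. \<Sum>m\<le>K. (num_trees (n - m) / num_trees n - fps_nth (height_fps (Suc m)) (n - m) / num_trees n) * num_forests m)
     \<longlonglongrightarrow> (\<Sum>m\<le>K. ((1 / 5) ^ m - 0 * (1 / 5) ^ m) * num_forests m)"
  proof (intro tendsto_sum tendsto_mult tendsto_diff tendsto_const num_trees_shift_ratio shift_ratio)
    fix m
    obtain x s where "x > 1 / 5" "abs_sums (height_fps (Suc m)) x s"
      using height_fps_sums[of "Suc m"] by auto
    then show "(\<lambda>n. fps_nth (height_fps (Suc m)) n / num_trees n) \<longlonglongrightarrow> 0"
      by (intro abs_sums_negligible)
  qed
  then show ?thesis
    by (simp add: sum_divide_distrib diff_divide_distrib[symmetric] mult.commute)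
qed

text \<open>Forests of bounded height are negligible, and each remaining term with shift k has the
  limit ratio 25/9 times 5^(-k).\<close>

lemma deepest_ratio_upper:
  assumes "K \<ge> 1"
  shows "(\<lambda>n. (num_forests n - (\<Sum>k\<le>K. num_trees k * num_forests (n - k))
     + (\<Sum>k\<le>K. num_trees k * fps_nth (forest_fps K) (n - k))) / num_trees n)
     \<longlonglongrightarrow> 25 / 9 * (1 - (\<Sum>k\<le>K. num_trees k * (1 / 5) ^ k))"
proof -
  obtain x v where x: "x > 1 / 5" "abs_sums (forest_fps K) x v"
    using forest_fps_sums[OF assms] by auto
  have "(\<lambda>n. num_forests n / num_trees n - (\<Sum>k\<le>K. num_trees k * (num_forests (n - k) / num_trees n))
     + (\<Sum>k\<le>K. num_trees k * (fps_nth (forest_fps K) (n - k) / num_trees n)))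
     \<longlonglongrightarrow> 25 / 9 - (\<Sum>k\<le>K. num_trees k * (25 / 9 * (1 / 5) ^ k)) + (\<Sum>k\<le>K. num_trees k * (0 * (1 / 5) ^ k))"
    by (intro tendsto_add tendsto_diff tendsto_sum tendsto_mult tendsto_const shift_ratio
        num_forests_ratio abs_sums_negligible[OF x(2,1)])
  moreover have "25 / 9 - (\<Sum>k\<le>K. num_trees k * (25 / 9 * (1 / 5) ^ k)) + (\<Sum>k\<le>K. num_trees k * (0 * (1 / 5) ^ k))
     = 25 / 9 * (1 - (\<Sum>k\<le>K. num_trees k * (1 / 5) ^ k))"
    by (simp add: right_diff_distrib sum_distrib_left mult.left_commute)
  moreover have "num_forests n / num_trees n - (\<Sum>k\<le>K. num_trees k * (num_forests (n - k) / num_trees n))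
     + (\<Sum>k\<le>K. num_trees k * (fps_nth (forest_fps K) (n - k) / num_trees n)) =
     (num_forests n - (\<Sum>k\<le>K. num_trees k * num_forests (n - k))
     + (\<Sum>k\<le>K. num_trees k * fps_nth (forest_fps K) (n - k))) / num_trees n" for n
    by (simp add: sum_divide_distrib add_divide_distrib diff_divide_distrib)
  ultimately show ?thesis by (simp only:)
qed

text \<open>K is fixed before n tends to infinity. As K grows, the limit of the lower bound tends to
  5/3 and that of the upper bound to 25/9 * (1 - 2/5), which is the same number.\<close>

lemma total_deepest_ratio: "(\<lambda>n. total_deepest n / num_trees n) \<longlonglongrightarrow> 5 / 3"
proof (rule order_tendstoI)
  fix y :: real assume "y < 5 / 3"
  moreover have "(\<lambda>K. \<Sum>m\<le>K. num_forests m * (1 / 5) ^ m) \<longlonglongrightarrow> 5 / 3"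
    using num_sums(2) by (simp only: sums_def_le)
  ultimately have "\<forall>\<^sub>F K in sequentially. y < (\<Sum>m\<le>K. num_forests m * (1 / 5) ^ m)"
    by (intro order_tendstoD(1))
  then obtain K where K: "y < (\<Sum>m\<le>K. num_forests m * (1 / 5) ^ m)"
    using eventually_happens' trivial_limit_sequentially by blast
  show "\<forall>\<^sub>F n in sequentially. y < total_deepest n / num_trees n"
    using order_tendstoD(1)[OF deepest_ratio_lower K] eventually_ge_at_top[of "Suc (Suc K)"]
  proof eventually_elim
    case (elim n)
    have "num_trees n > 0" using elim by (intro weight_fps_nth_pos) simp
    then show ?case
      using elim(1) divide_right_mono[OF total_deepest_lower[of K n], of "num_trees n"] elim(2) by simp
  qed
next
  fix y :: real assume y: "y > 5 / 3"
  have "(\<lambda>K. 25 / 9 * (1 - (\<Sum>k\<le>K. num_trees k * (1 / 5) ^ k))) \<longlonglongrightarrow> 25 / 9 * (1 - 2 / 5)"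
    using num_sums(1) unfolding sums_def_le by (intro tendsto_intros)
  then have "\<forall>\<^sub>F K in sequentially. 25 / 9 * (1 - (\<Sum>k\<le>K. num_trees k * (1 / 5) ^ k)) < y"
    using y by (intro order_tendstoD(2)) auto
  then have "\<forall>\<^sub>F K in sequentially. K \<ge> 1 \<and> 25 / 9 * (1 - (\<Sum>k\<le>K. num_trees k * (1 / 5) ^ k)) < y"
    using eventually_ge_at_top[of 1] by eventually_elim simp
  then obtain K where K: "K \<ge> 1" "25 / 9 * (1 - (\<Sum>k\<le>K. num_trees k * (1 / 5) ^ k)) < y"
    using eventually_happens' trivial_limit_sequentially by blast
  show "\<forall>\<^sub>F n in sequentially. total_deepest n / num_trees n < y"
    using order_tendstoD(2)[OF deepest_ratio_upper[OF K(1)] K(2)] eventually_ge_at_top[of "Suc (Suc K)"]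
  proof eventually_elim
    case (elim n)
    have "num_trees n > 0" using elim by (intro weight_fps_nth_pos) simp
    then show ?case
      using elim(1) divide_right_mono[OF total_deepest_upper[of K n], of "num_trees n"] elim(2) by simp
  qed
qed

theorem theorem2:
  "(\<lambda>n. measure_pmf.expectation (pmf_of_set (marked_trees n))
           (\<lambda>(t, M). real (card (deepest_nodes t)))) \<longlonglongrightarrow> 5 / 3"
proof (rule Lim_transform_eventually[OF total_deepest_ratio])
  show "\<forall>\<^sub>F n in sequentially. total_deepest n / num_trees n =
      measure_pmf.expectation (pmf_of_set (marked_trees n)) (\<lambda>(t, M). real (card (deepest_nodes t)))"
    using eventually_ge_at_top[of 1] by eventually_elim (rule expectation_deepest[symmetric])
qed

end
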